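(* Let $(\Sigma_1,Q_1,\{v_1,\ldots,v_d\})$ and $(\Sigma_2,Q_2,\{u_1,\ldots,u_l\})$ be fan fundamental triples in $\mathbb{R}^n$ and $\mathbb{R}^m$ respectively, where $\Sigma_1,\Sigma_2$ are simplicial fans with convex support of full dimension, with associated algebraic toric quasifolds $X_{\Sigma_1}$ and $X_{\Sigma_2}$. Let $\Sigma_1\to\Sigma_2$ be a fan morphism. Then there is an induced map $\Phi\colon X_{\Sigma_1}\to X_{\Sigma_2}$, which is equivariant with respect to the actions of the corresponding quasitori.
   Context: A quasilattice $Q$ in $\mathbb{R}^n$ is the $\mathbb{Z}$-span of a set of vectors that spans $\mathbb{R}^n$. A simplicial cone is the set of non-negative real combinations of linearly independent vectors (its ray generators); its faces are the cones generated by subsets of the ray generators (including $\{0\}$ and the cone itself). A simplicial fan $\Sigma$ in $\mathbb{R}^n$ is a finite collection of simplicial cones such that every face of a cone of $\Sigma$ is in $\Sigma$ and the intersection of any two cones of $\Sigma$ is a face of each. Its support is the union of its cones. A maximal cone is an $n$-dimensional one. A fan fundamental triple $(\Sigma,Q,\{v_1,\ldots,v_d\})$ in $\mathbb{R}^n$ consists of a quasilattice $Q\subset\mathbb{R}^n$, a simplicial fan $\Sigma$ with $d$ rays, and vectors $v_1,\ldots,v_d\in Q$ generating the $d$ rays of $\Sigma$. A fan morphism $\Sigma_1\to\Sigma_2$ (with quasilattices $Q_1\subset\mathbb{R}^n$, $Q_2\subset\mathbb{R}^m$) is the datum of a linear map $f\colon\mathbb{R}^n\to\mathbb{R}^m$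 with $f(Q_1)\subset Q_2$ such that for each $\delta_1\in\Sigma_1$ there is $\delta_2\in\Sigma_2$ with $f(\delta_1)\subset\delta_2$. Affine pieces. For a maximal cone $\sigma\in\Sigma$, let $I_\sigma\subset\{1,\ldots,d\}$ be the set of $n$ indices with $\sigma$ generated by $\{v_i\}_{i\in I_\sigma}$, let $\{\alpha_i^\sigma\}_{i\in I_\sigma}$ be the basis of $(\mathbb{R}^n)^*$ dual to $\{v_i\}_{i\in I_\sigma}$, let $L_\sigma=\bigoplus_{i\in I_\sigma}\mathbb{Z}v_i\subset Q$ and $\Gamma_\sigma=Q/L_\sigma$, acting on $\mathbb{C}^{I_\sigma}$ by $[v]\cdot(z_i)_{i}=(e^{2\pi \sqrt{-1}\,\alpha_i^\sigma(v)}z_i)_{i}$, $v\in Q$. For a face $\delta$ of $\sigma$, generated by $\{v_i\}_{i\in I_\delta}$, let $U_\delta^\sigma=\{z\in\mathbb{C}^{I_\sigma}\mid z_i\ne0\text{ for }i\in I_\sigma\setminus I_\delta\}$ and $X_\delta^\sigma=U_\delta^\sigma/\Gamma_\sigma$. If $\rho$ is a face of $\delta$, then $X_\rho^\sigma$ is regarded as a subset of $X_\delta^\sigma$ via $U_\rho^\sigma\subset U_\delta^\sigma$. Affine toric morphisms. Let $\sigma_1,\sigma_2$ be maximal cones of fans with fundamental triples having quasilattices $Q_1\subset\mathbb{R}^n$, $Q_2\subset\mathbb{R}^m$, let $\delta_1,\delta_2$ be faces of $\sigma_1,\sigma_2$, and let $f\colon\mathbb{R}^n\to\mathbb{R}^m$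 be linear with $f(Q_1)\subset Q_2$, $f(\delta_1)\subset\delta_2$. Denote the chosen ray generators of $\sigma_1$ by $v_k$ ($k\in I_{\sigma_1}$) and the basis dual to those of $\sigma_2$ by $\alpha_j^{\sigma_2}$ ($j\in I_{\sigma_2}$). The affine toric morphism induced by $f$ is the well-defined map $$\Phi_{\delta_2\delta_1}\colon X_{\delta_1}^{\sigma_1}\to X_{\delta_2}^{\sigma_2},\quad[(z_k)_{k}]\mapsto\Big[\Big(\prod_{k\in I_{\sigma_1}}z_k^{\alpha_j^{\sigma_2}(f(v_k))}\Big)_{j\in I_{\sigma_2}}\Big].$$ Convention on real powers: for each nonzero $z_k$ choose $x_k\in\mathbb{C}$ with $z_k=e^{2\pi \sqrt{-1}\, x_k}$ (the same choice for all monomials) and set $z_k^a=e^{2\pi \sqrt{-1}\, a x_k}$, $a\in\mathbb{R}$; if $z_k=0$, then $z_k^a=0$ for $a>0$ and $z_k^0=1$ (negative exponents do not occur for $z_k=0$). Gluing. For $\delta$ a face of $\sigma$, $\gamma$ a face of $\tau$ ($\sigma,\tau\in\Sigma$ maximal), let $h_{\gamma\delta}\colon X^\sigma_{\delta\cap\gamma}\to X^\tau_{\delta\cap\gamma}$ be the affine toric morphism induced by the identity of $\mathbb{R}^n$. The algebraic toric quasifold of the triple is $X_\Sigma=\big(\bigsqcup_{\delta\subset\sigma}X_\delta^\sigma\big)/\sim$, the disjoint union being over pairs with $\sigma\in\Sigma$ maximal and $\delta$ a face of $\sigma$, where for $y\in X_\delta^\sigma$, $y'\in X_\gamma^\tau$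 one sets $y\sim y'$ iff $y\in X^\sigma_{\delta\cap\gamma}$, $y'\in X^\tau_{\delta\cap\gamma}$ and $y'=h_{\gamma\delta}(y)$; this is an equivalence relation. Terminology: a map $X_{\Sigma_1}\to X_{\Sigma_2}$ is induced by the fan morphism given by $f$ in the sense that on the affine pieces it is given by the affine toric morphisms $\Phi_{\delta_2\delta_1}$ induced by $f$. Quasitorus action. The quasitorus corresponding to $X_\Sigma$ is $\mathbb{C}^n/Q$; it acts on $X_\Sigma$ by $[u]\cdot[y]=\big[[(e^{2\pi \sqrt{-1}\,\alpha_i^\sigma(u)}z_i)_{i\in I_\sigma}]\big]$ for $u\in\mathbb{C}^n$ and $y=[(z_i)_{i\in I_\sigma}]\in X_\delta^\sigma$, where $\alpha_i^\sigma$ is extended $\mathbb{C}$-linearly to $\mathbb{C}^n$. Equivariance of $\Phi$ is with respect to the homomorphism $\mathbb{C}^n/Q_1\to\mathbb{C}^m/Q_2$ induced by the $\mathbb{C}$-linear extension of $f$, i.e. $\Phi([u]\cdot p)=[f(u)]\cdot\Phi(p)$. *)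

theory Defs
  imports "HOL-Analysis.Analysis"
begin

definition int_span :: "(real^'n::finite) set \<Rightarrow> (real^'n) set" where
  "int_span S = {(\<Sum>s\<in>F. of_int (c s) *\<^sub>R s) | F c. finite F \<and> F \<subseteq> S}"

definition quasilattice :: "(real^'n::finite) set \<Rightarrow> bool" where
  "quasilattice Q \<longleftrightarrow> (\<exists>S. span S = UNIV \<and> Q = int_span S)"

text \<open>Only used for finite \<open>B\<close>; \<open>cone_gen {} = {0}\<close>.\<close>
definition cone_gen :: "(real^'n::finite) set \<Rightarrow> (real^'n) set" where
  "cone_gen B = {(\<Sum>b\<in>B. c b *\<^sub>R b) | c. \<forall>b\<in>B. 0 \<le> c b}"

definition simplicial_cone :: "(real^'n::finite) set \<Rightarrow> bool" where
  "simplicial_cone \<sigma> \<longleftrightarrow> (\<exists>B. independent B \<and> \<sigma> = cone_gen B)"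

definition cone_face :: "(real^'n::finite) set \<Rightarrow> (real^'n) set \<Rightarrow> bool" where
  "cone_face \<tau> \<sigma> \<longleftrightarrow> (\<exists>B C. independent B \<and> \<sigma> = cone_gen B \<and> C \<subseteq> B \<and> \<tau> = cone_gen C)"

definition simplicial_fan :: "(real^'n::finite) set set \<Rightarrow> bool" where
  "simplicial_fan \<Sigma> \<longleftrightarrow>
     finite \<Sigma> \<and>
     (\<forall>\<sigma>\<in>\<Sigma>. simplicial_cone \<sigma>) \<and>
     (\<forall>\<sigma>\<in>\<Sigma>. \<forall>\<tau>. cone_face \<tau> \<sigma> \<longrightarrow> \<tau> \<in> \<Sigma>) \<and>
     (\<forall>\<sigma>\<in>\<Sigma>. \<forall>\<tau>\<in>\<Sigma>. cone_face (\<sigma> \<inter> \<tau>) \<sigma> \<and> cone_face (\<sigma> \<inter> \<tau>) \<tau>)"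

record ('n::finite) fan_triple =
  fan :: "(real^'n) set set"
  qlat :: "(real^'n) set"
  nrays :: nat
  gen :: "nat \<Rightarrow> real^'n"

text \<open>Only the values of \<open>gen T\<close> on \<open>{1..nrays T}\<close> matter.\<close>
definition fan_fundamental_triple :: "'n::finite fan_triple \<Rightarrow> bool" where
  "fan_fundamental_triple T \<longleftrightarrow>
     quasilattice (qlat T) \<and>
     simplicial_fan (fan T) \<and>
     (\<forall>i\<in>{1..nrays T}. gen T i \<in> qlat T) \<and>
     bij_betw (\<lambda>i. cone_gen {gen T i}) {1..nrays T} {\<rho> \<in> fan T. dim \<rho> = 1}"

definition fan_support :: "'n::finite fan_triple \<Rightarrow> (real^'n) set" where
  "fan_support T = \<Union> (fan T)"

definition max_cones :: "'n::finite fan_triple \<Rightarrow> (real^'n) set set" where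
  "max_cones T = {\<sigma> \<in> fan T. dim \<sigma> = CARD('n)}"

definition fan_morphism ::
  "'n::finite fan_triple \<Rightarrow> 'm::finite fan_triple \<Rightarrow> (real^'n \<Rightarrow> real^'m) \<Rightarrow> bool" where
  "fan_morphism T\<^sub>1 T\<^sub>2 f \<longleftrightarrow>
     linear f \<and> f ` qlat T\<^sub>1 \<subseteq> qlat T\<^sub>2 \<and>
     (\<forall>\<delta>\<^sub>1\<in>fan T\<^sub>1. \<exists>\<delta>\<^sub>2\<in>fan T\<^sub>2. f ` \<delta>\<^sub>1 \<subseteq> \<delta>\<^sub>2)"

definition cone_idx :: "'n::finite fan_triple \<Rightarrow> (real^'n) set \<Rightarrow> nat set" where
  "cone_idx T \<delta> = (THE I. I \<subseteq> {1..nrays T} \<and> card I = dim \<delta> \<and> \<delta> = cone_gen (gen T ` I))"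

definition dual_basis :: "'n::finite fan_triple \<Rightarrow> (real^'n) set \<Rightarrow> nat \<Rightarrow> real^'n \<Rightarrow> real" where
  "dual_basis T \<sigma> i =
     (THE \<alpha>. linear \<alpha> \<and> (\<forall>j\<in>cone_idx T \<sigma>. \<alpha> (gen T j) = (if j = i then 1 else 0)))"

definition e2pi :: "complex \<Rightarrow> complex" where
  "e2pi x = exp (2 * of_real pi * \<i> * x)"

text \<open>The space of complex vectors indexed by \<open>I\<close> is rendered as \<open>I \<rightarrow>\<^sub>E UNIV\<close>.\<close>
definition affine_open ::
  "'n::finite fan_triple \<Rightarrow> (real^'n) set \<Rightarrow> (real^'n) set \<Rightarrow> (nat \<Rightarrow> complex) set" where
  "affine_open T \<sigma> \<delta> =
     {z \<in> cone_idx T \<sigma> \<rightarrow>\<^sub>E UNIV. \<forall>i \<in> cone_idx T \<sigma> - cone_idx T \<delta>. z i \<noteq> 0}"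

text \<open>The orbit relation of \<open>\<Gamma>\<^sub>\<sigma> = Q / L\<^sub>\<sigma>\<close>: the group acts through representatives in \<open>Q\<close>,
  and \<open>L\<^sub>\<sigma>\<close> acts trivially.\<close>
definition orbit_rel ::
  "'n::finite fan_triple \<Rightarrow> (real^'n) set \<Rightarrow> ((nat \<Rightarrow> complex) \<times> (nat \<Rightarrow> complex)) set" where
  "orbit_rel T \<sigma> =
     {(z, w). z \<in> cone_idx T \<sigma> \<rightarrow>\<^sub>E UNIV \<and>
        (\<exists>q\<in>qlat T. w = (\<lambda>i\<in>cone_idx T \<sigma>. e2pi (of_real (dual_basis T \<sigma> i q)) * z i))}"

text \<open>As a set of orbits, \<open>affine_piece T \<sigma> \<rho>\<close> is literally a subset of
  \<open>affine_piece T \<sigma> \<delta>\<close> whenever \<open>\<rho>\<close> is a face of \<open>\<delta>\<close>.\<close>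
definition affine_piece ::
  "'n::finite fan_triple \<Rightarrow> (real^'n) set \<Rightarrow> (real^'n) set \<Rightarrow> (nat \<Rightarrow> complex) set set" where
  "affine_piece T \<sigma> \<delta> = affine_open T \<sigma> \<delta> // orbit_rel T \<sigma>"

text \<open>\<open>real_pow z x a\<close> is the real power \<open>z\<^sup>a\<close> computed with the choice \<open>x\<close> of a logarithm,
  \<open>z = e2pi x\<close>. Negative exponents of \<open>0\<close> do not occur; the value \<open>0\<close> there is irrelevant.\<close>
definition real_pow :: "complex \<Rightarrow> complex \<Rightarrow> real \<Rightarrow> complex" where
  "real_pow z x a = (if z = 0 then (if a = 0 then 1 else 0) else e2pi (of_real a * x))"

text \<open>The formula on representatives does not mention \<open>\<delta>\<^sub>1\<close> and \<open>\<delta>\<^sub>2\<close>, which only determine the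
  domain and the codomain. As usual for maps out of a quotient, the value is the union of the
  classes obtained from all representatives \<open>z\<close> of \<open>y\<close> and, here, all choices \<open>x\<close> of logarithms;
  it is a single class precisely because the map is well defined.\<close>
definition affine_toric_map ::
  "'n::finite fan_triple \<Rightarrow> 'm::finite fan_triple \<Rightarrow> (real^'n \<Rightarrow> real^'m) \<Rightarrow>
     (real^'n) set \<Rightarrow> (real^'m) set \<Rightarrow> (nat \<Rightarrow> complex) set \<Rightarrow> (nat \<Rightarrow> complex) set" where
  "affine_toric_map T\<^sub>1 T\<^sub>2 f \<sigma>\<^sub>1 \<sigma>\<^sub>2 y =
     (\<Union>z\<in>y. \<Union>x\<in>{x. \<forall>k\<in>cone_idx T\<^sub>1 \<sigma>\<^sub>1. z k \<noteq> 0 \<longrightarrow> z k = e2pi (x k)}.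
        orbit_rel T\<^sub>2 \<sigma>\<^sub>2 `` {\<lambda>j\<in>cone_idx T\<^sub>2 \<sigma>\<^sub>2.
          \<Prod>k\<in>cone_idx T\<^sub>1 \<sigma>\<^sub>1. real_pow (z k) (x k) (dual_basis T\<^sub>2 \<sigma>\<^sub>2 j (f (gen T\<^sub>1 k)))})"

text \<open>Points of the disjoint union of the affine pieces are tagged by the pair \<open>(\<sigma>, \<delta>)\<close>.\<close>
type_synonym 'n piece_point = "(real^'n) set \<times> (real^'n) set \<times> (nat \<Rightarrow> complex) set"

definition piece_points :: "'n::finite fan_triple \<Rightarrow> 'n piece_point set" where
  "piece_points T =
     {(\<sigma>, \<delta>, y). \<sigma> \<in> max_cones T \<and> cone_face \<delta> \<sigma> \<and> y \<in> affine_piece T \<sigma> \<delta>}"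

definition glue_rel :: "'n::finite fan_triple \<Rightarrow> ('n piece_point \<times> 'n piece_point) set" where
  "glue_rel T =
     {((\<sigma>, \<delta>, y), (\<tau>, \<gamma>, y')).
        (\<sigma>, \<delta>, y) \<in> piece_points T \<and> (\<tau>, \<gamma>, y') \<in> piece_points T \<and>
        y \<in> affine_piece T \<sigma> (\<delta> \<inter> \<gamma>) \<and> y' \<in> affine_piece T \<tau> (\<delta> \<inter> \<gamma>) \<and>
        y' = affine_toric_map T T id \<sigma> \<tau> y}"

definition toric_quasifold :: "'n::finite fan_triple \<Rightarrow> 'n piece_point set set" where
  "toric_quasifold T = piece_points T // glue_rel T"

text \<open>The requirement that every piece of the source admits a target piece, a consequence of the
  assumptions on the fans, ensures that the second condition determines \<open>\<Phi>\<close> on the whole source.\<close>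
definition induced_by ::
  "'n::finite fan_triple \<Rightarrow> 'm::finite fan_triple \<Rightarrow> (real^'n \<Rightarrow> real^'m) \<Rightarrow>
     ('n piece_point set \<Rightarrow> 'm piece_point set) \<Rightarrow> bool" where
  "induced_by T\<^sub>1 T\<^sub>2 f \<Phi> \<longleftrightarrow>
     (\<forall>\<sigma>\<^sub>1\<in>max_cones T\<^sub>1. \<forall>\<delta>\<^sub>1. cone_face \<delta>\<^sub>1 \<sigma>\<^sub>1 \<longrightarrow>
        (\<exists>\<sigma>\<^sub>2\<in>max_cones T\<^sub>2. \<exists>\<delta>\<^sub>2. cone_face \<delta>\<^sub>2 \<sigma>\<^sub>2 \<and> f ` \<delta>\<^sub>1 \<subseteq> \<delta>\<^sub>2) \<and>
        (\<forall>\<sigma>\<^sub>2\<in>max_cones T\<^sub>2. \<forall>\<delta>\<^sub>2. cone_face \<delta>\<^sub>2 \<sigma>\<^sub>2 \<and> f ` \<delta>\<^sub>1 \<subseteq> \<delta>\<^sub>2 \<longrightarrow>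
           (\<forall>y\<in>affine_piece T\<^sub>1 \<sigma>\<^sub>1 \<delta>\<^sub>1.
              affine_toric_map T\<^sub>1 T\<^sub>2 f \<sigma>\<^sub>1 \<sigma>\<^sub>2 y \<in> affine_piece T\<^sub>2 \<sigma>\<^sub>2 \<delta>\<^sub>2 \<and>
              \<Phi> (glue_rel T\<^sub>1 `` {(\<sigma>\<^sub>1, \<delta>\<^sub>1, y)}) =
                glue_rel T\<^sub>2 `` {(\<sigma>\<^sub>2, \<delta>\<^sub>2, affine_toric_map T\<^sub>1 T\<^sub>2 f \<sigma>\<^sub>1 \<sigma>\<^sub>2 y)})))"

definition cfunctional :: "(real^'n::finite \<Rightarrow> real) \<Rightarrow> complex^'n \<Rightarrow> complex" where
  "cfunctional \<alpha> u = Complex (\<alpha> (\<chi> k. Re (u $ k))) (\<alpha> (\<chi> k. Im (u $ k)))"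

definition clinear_map :: "(real^'n::finite \<Rightarrow> real^'m::finite) \<Rightarrow> complex^'n \<Rightarrow> complex^'m" where
  "clinear_map f u = (\<chi> j. cfunctional (\<lambda>x. f x $ j) u)"

definition torus_rel :: "'n::finite fan_triple \<Rightarrow> ((complex^'n) \<times> (complex^'n)) set" where
  "torus_rel T = {(u, w). \<exists>q\<in>qlat T. w = u + (\<chi> k. of_real (q $ k))}"

definition quasitorus :: "'n::finite fan_triple \<Rightarrow> (complex^'n) set set" where
  "quasitorus T = UNIV // torus_rel T"

definition quasitorus_hom ::
  "'m::finite fan_triple \<Rightarrow> (real^'n::finite \<Rightarrow> real^'m) \<Rightarrow> (complex^'n) set \<Rightarrow> (complex^'m) set" where
  "quasitorus_hom T\<^sub>2 f t = (\<Union>u\<in>t. torus_rel T\<^sub>2 `` {clinear_map f u})"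

definition piece_act ::
  "'n::finite fan_triple \<Rightarrow> (real^'n) set \<Rightarrow> complex^'n \<Rightarrow>
     (nat \<Rightarrow> complex) set \<Rightarrow> (nat \<Rightarrow> complex) set" where
  "piece_act T \<sigma> u y =
     (\<Union>z\<in>y. orbit_rel T \<sigma> ``
        {\<lambda>i\<in>cone_idx T \<sigma>. e2pi (cfunctional (dual_basis T \<sigma> i) u) * z i})"

definition quasitorus_act ::
  "'n::finite fan_triple \<Rightarrow> (complex^'n) set \<Rightarrow> 'n piece_point set \<Rightarrow> 'n piece_point set" where
  "quasitorus_act T t p =
     (\<Union>u\<in>t. \<Union>(\<sigma>, \<delta>, y)\<in>p. glue_rel T `` {(\<sigma>, \<delta>, piece_act T \<sigma> u y)})"

definition quasitorus_equivariant ::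
  "'n::finite fan_triple \<Rightarrow> 'm::finite fan_triple \<Rightarrow> (real^'n \<Rightarrow> real^'m) \<Rightarrow>
     ('n piece_point set \<Rightarrow> 'm piece_point set) \<Rightarrow> bool" where
  "quasitorus_equivariant T\<^sub>1 T\<^sub>2 f \<Phi> \<longleftrightarrow>
     (\<forall>t\<in>quasitorus T\<^sub>1. \<forall>p\<in>toric_quasifold T\<^sub>1.
        \<Phi> (quasitorus_act T\<^sub>1 t p) = quasitorus_act T\<^sub>2 (quasitorus_hom T\<^sub>2 f t) (\<Phi> p))"

end

theory Submission
  imports Defs
begin

text \<open>Every monomial of an affine toric morphism is either killed by a vanishing coordinate or a single
  exponential \<open>e2pi\<close> of a linear form in the logarithms. Multiplying the coordinates by \<open>e2pi c\<close> hence
  multiplies the monomials by \<open>e2pi\<close> of the linear image of \<open>c\<close>; with \<open>c\<close> coming from \<open>qlat\<close> and from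
  the integral ambiguity of the logarithms this is well-definedness on orbits, with \<open>c\<close> coming from the
  complex torus it is equivariance. Affine toric morphisms compose as long as the exponents at vanishing
  coordinates are nonnegative, which holds when cones are mapped into cones. Composing with the
  gluing maps, which are induced by the identity, shows that gluing is an equivalence relation
  and that the affine morphisms are compatible with it. Convexity of the full-dimensional support of
  the target provides a maximal cone above each cone.\<close>

section \<open>Simplicial cones and their rays\<close>

text \<open>The bases in the definitions of cones and faces are existential, while charts are
  indexed by the chosen generators, so the two have to be matched first. The main obstacle is that
  exponents of gluing maps can be negative: a generator of \<sigma> may have coordinates of any sign
  in the basis of another maximal cone \<tau>. This is harmless because on the chart of a face only
  coordinates belonging to rays of that face can vanish, and a morphism sends these rays into the
  target cone. For this reason every composition is carried out over a cone common to the charts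
  involved. Logarithms are ambiguous by integers n_k; since the generators v_k lie in Q, the sum of
  n_k v_k is one more lattice vector and the ambiguity is absorbed into the orbit. Transitivity of
  gluing needs in addition that the piece of an intersection of cones is the intersection of the
  pieces, which is true for orbits because the open sets are stable under the action.\<close>

lemma independent_coeff_unique:
  fixes B :: "'a::euclidean_space set"
  assumes "independent B" and "(\<Sum>b\<in>B. u b *\<^sub>R b) = (\<Sum>b\<in>B. v b *\<^sub>R b)" and "b \<in> B"
  shows "u b = v b"
proof -
  have "(\<Sum>b\<in>B. (u b - v b) *\<^sub>R b) = 0"
    using assms(2) by (simp add: scaleR_diff_left sum_subtractf)
  then have "u b - v b = 0"
    using independentD[OF assms(1) independent_imp_finite[OF assms(1)] order_refl] assms(3)
    by fastforce
  then show ?thesis by simp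
qed

lemma cone_gen_sum:
  assumes "\<And>a. a \<in> A \<Longrightarrow> 0 \<le> c a" and "\<And>a. a \<in> A \<Longrightarrow> g a \<in> cone_gen B"
  shows "(\<Sum>a\<in>A. c a *\<^sub>R g a) \<in> cone_gen B"
proof -
  have "\<forall>a\<in>A. \<exists>e. (\<forall>b\<in>B. 0 \<le> e b) \<and> g a = (\<Sum>b\<in>B. e b *\<^sub>R b)"
    using assms(2) unfolding cone_gen_def by fastforce
  then obtain e where e: "\<And>a b. a \<in> A \<Longrightarrow> b \<in> B \<Longrightarrow> 0 \<le> e a b"
    and g: "\<And>a. a \<in> A \<Longrightarrow> g a = (\<Sum>b\<in>B. e a b *\<^sub>R b)"
    by metis
  have "(\<Sum>a\<in>A. c a *\<^sub>R g a) = (\<Sum>a\<in>A. \<Sum>b\<in>B. (c a * e a b) *\<^sub>R b)"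
    using g by (simp add: scaleR_sum_right)
  also have "\<dots> = (\<Sum>b\<in>B. (\<Sum>a\<in>A. c a * e a b) *\<^sub>R b)"
    by (subst sum.swap) (simp add: scaleR_sum_left)
  finally show ?thesis
    unfolding cone_gen_def using assms(1) e by (auto intro!: sum_nonneg exI)
qed

lemma cone_gen_base:
  assumes "finite B" and "b \<in> B" shows "b \<in> cone_gen B"
proof -
  have "b = (\<Sum>x\<in>B. (if x = b then 1 else 0) *\<^sub>R x)"
    using assms by (simp add: if_distrib[of "\<lambda>c. c *\<^sub>R _"] sum.delta cong: if_cong)
  then show ?thesis
    unfolding cone_gen_def by (auto intro!: exI[of _ "\<lambda>x. if x = b then 1 else 0"])
qed

lemma cone_gen_subset:
  assumes "B \<subseteq> cone_gen C" shows "cone_gen B \<subseteq> cone_gen C"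
proof
  fix x assume "x \<in> cone_gen B"
  then obtain c where "\<forall>b\<in>B. 0 \<le> c b" "x = (\<Sum>b\<in>B. c b *\<^sub>R b)"
    unfolding cone_gen_def by auto
  then show "x \<in> cone_gen C" using cone_gen_sum[of B c "\<lambda>b. b" C] assms by auto
qed

lemma cone_gen_scale:
  assumes "x \<in> cone_gen B" and "0 \<le> t" shows "t *\<^sub>R x \<in> cone_gen B"
  using cone_gen_sum[of "{()}" "\<lambda>_. t" "\<lambda>_. x" B] assms by simp

lemma cone_gen_singleton: "cone_gen {v} = {c *\<^sub>R v |c. 0 \<le> c}"
  unfolding cone_gen_def by (auto intro: exI[of _ "\<lambda>_. _"])

lemma span_cone_gen:
  assumes "finite B" shows "span (cone_gen B) = span B"
proof (rule span_eq[THEN iffD2], intro conjI)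
  show "cone_gen B \<subseteq> span B"
    unfolding cone_gen_def by (auto intro!: span_sum intro: span_scale span_base)
  show "B \<subseteq> span (cone_gen B)"
    using cone_gen_base[OF assms] by (auto intro: span_base)
qed

lemma dim_cone_gen:
  assumes "independent B" shows "dim (cone_gen B) = card B"
  by (metis assms dim_span dim_span_eq_card_independent independent_imp_finite span_cone_gen)

text \<open>Expanding a generator of one system in the other and back, nonnegativity leaves no room for
  cancellation.\<close>
lemma cone_gen_rays_unique:
  assumes B: "independent B" and C: "independent C" and eq: "cone_gen B = cone_gen C"
    and b: "b \<in> B"
  obtains c t where "c \<in> C" "0 < t" "c = t *\<^sub>R b"
proof -
  have fin: "finite B" "finite C"
    using B C by (auto intro: independent_imp_finite)
  have "b \<in> cone_gen C" using cone_gen_base[OF fin(1) b] eq by simp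
  then obtain e where e: "\<And>c. c \<in> C \<Longrightarrow> 0 \<le> e c" "b = (\<Sum>c\<in>C. e c *\<^sub>R c)"
    unfolding cone_gen_def by auto
  have "b \<noteq> 0" using B b dependent_zero by blast
  moreover have "b = 0" if "\<forall>c\<in>C. e c = 0"
    unfolding e(2) using that by (intro sum.neutral) auto
  ultimately obtain c where c: "c \<in> C" "e c \<noteq> 0" by metis
  have "\<exists>d. (\<forall>s\<in>B. 0 \<le> d s) \<and> c = (\<Sum>s\<in>B. d s *\<^sub>R s)" if "c \<in> C" for c
    using cone_gen_base[OF fin(2) that] unfolding eq[symmetric] unfolding cone_gen_def by blast
  then have "\<exists>d. \<forall>c\<in>C. (\<forall>s\<in>B. 0 \<le> d c s) \<and> c = (\<Sum>s\<in>B. d c s *\<^sub>R s)"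
    by (intro bchoice) blast
  then obtain d where d: "\<And>c s. c \<in> C \<Longrightarrow> s \<in> B \<Longrightarrow> 0 \<le> d c s"
    and ceq: "\<And>c. c \<in> C \<Longrightarrow> c = (\<Sum>s\<in>B. d c s *\<^sub>R s)"
    by blast
  have "b = (\<Sum>c\<in>C. e c *\<^sub>R (\<Sum>s\<in>B. d c s *\<^sub>R s))"
    unfolding e(2) by (rule sum.cong) (simp_all flip: ceq)
  also have "\<dots> = (\<Sum>s\<in>B. (\<Sum>c\<in>C. e c * d c s) *\<^sub>R s)"
    by (simp add: scaleR_sum_right scaleR_sum_left) (rule sum.swap)
  finally have "(\<Sum>s\<in>B. (\<Sum>c\<in>C. e c * d c s) *\<^sub>R s) = (\<Sum>s\<in>B. (if s = b then 1 else 0) *\<^sub>R s)"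
    using fin b by (simp add: if_distrib[of "\<lambda>c. c *\<^sub>R _"] sum.delta cong: if_cong)
  then have "\<And>s. s \<in> B \<Longrightarrow> (\<Sum>c\<in>C. e c * d c s) = (if s = b then 1 else 0)"
    by (rule independent_coeff_unique[OF B])
  then have "\<And>s. s \<in> B - {b} \<Longrightarrow> \<forall>c\<in>C. e c * d c s = 0"
    using fin(2) e(1) d by (subst sum_nonneg_eq_0_iff[symmetric]) auto
  then have d0: "\<And>s. s \<in> B - {b} \<Longrightarrow> d c s = 0" using c by auto
  have "c = d c b *\<^sub>R b + (\<Sum>s\<in>B - {b}. d c s *\<^sub>R s)"
    by (subst ceq[OF c(1)]) (rule sum.remove[OF fin(1) b])
  also have "\<dots> = d c b *\<^sub>R b" using d0 by simp
  finally have cb: "c = d c b *\<^sub>R b" .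
  have "c \<noteq> 0" using C c dependent_zero by blast
  with cb have "d c b > 0" using d[OF c(1) b] by (metis less_eq_real_def scaleR_zero_left)
  with cb c show ?thesis using that by blast
qed

lemma cone_face_gen:
  assumes "independent B" and "C \<subseteq> B" shows "cone_face (cone_gen C) (cone_gen B)"
  using assms unfolding cone_face_def by blast

lemma cone_face_subset: "cone_face \<delta> \<sigma> \<Longrightarrow> \<delta> \<subseteq> \<sigma>"
  unfolding cone_face_def
  using cone_gen_subset cone_gen_base independent_imp_finite by (metis subset_iff)

section \<open>Chosen ray generators and index sets of the cones of a fan\<close>

context
  fixes T :: "'n::finite fan_triple"
  assumes T: "fan_fundamental_triple T"
begin

lemma fan_faceD: "\<sigma> \<in> fan T \<Longrightarrow> cone_face \<tau> \<sigma> \<Longrightarrow> \<tau> \<in> fan T"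
  using T unfolding fan_fundamental_triple_def simplicial_fan_def by blast

lemma fan_Int:
  "\<sigma> \<in> fan T \<Longrightarrow> \<tau> \<in> fan T \<Longrightarrow> cone_face (\<sigma> \<inter> \<tau>) \<sigma>"
  "\<sigma> \<in> fan T \<Longrightarrow> \<tau> \<in> fan T \<Longrightarrow> cone_face (\<sigma> \<inter> \<tau>) \<tau>"
  "\<sigma> \<in> fan T \<Longrightarrow> \<tau> \<in> fan T \<Longrightarrow> \<sigma> \<inter> \<tau> \<in> fan T"
  using T unfolding fan_fundamental_triple_def simplicial_fan_def by blast+

lemma fan_cone:
  assumes "\<sigma> \<in> fan T" obtains B where "independent B" "\<sigma> = cone_gen B"
  using T assms unfolding fan_fundamental_triple_def simplicial_fan_def simplicial_cone_def by blast

lemma ray_in_fan: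
  assumes "i \<in> {1..nrays T}"
  shows "cone_gen {gen T i} \<in> fan T" "dim (cone_gen {gen T i}) = 1" "gen T i \<noteq> 0"
proof -
  show 1: "cone_gen {gen T i} \<in> fan T" "dim (cone_gen {gen T i}) = 1"
    using T assms unfolding fan_fundamental_triple_def by (auto dest: bij_betwE)
  show "gen T i \<noteq> 0"
  proof
    assume "gen T i = 0"
    then have "cone_gen {gen T i} \<subseteq> {0}" by (auto simp: cone_gen_singleton)
    then show False using 1(2) dim_eq_0[of "cone_gen {gen T i}"] by simp
  qed
qed

text \<open>Positively proportional vectors generate the same ray, and the numbering of the rays is
  a bijection.\<close>

lemma ray_inj:
  assumes "i \<in> {1..nrays T}" "j \<in> {1..nrays T}" "gen T i = t *\<^sub>R gen T j" "0 < t"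
  shows "i = j"
proof -
  have j: "gen T j = (1 / t) *\<^sub>R gen T i" using assms by simp
  have "gen T j \<in> cone_gen {gen T i}"
    unfolding cone_gen_singleton mem_Collect_eq by (intro exI[of _ "1 / t"] conjI j) (use assms in simp)
  moreover have "gen T i \<in> cone_gen {gen T j}"
    unfolding cone_gen_singleton mem_Collect_eq by (intro exI[of _ t] conjI assms(3)) (use assms in simp)
  ultimately have "cone_gen {gen T i} = cone_gen {gen T j}"
    by (intro subset_antisym cone_gen_subset) auto
  then show ?thesis
    using T assms(1,2) unfolding fan_fundamental_triple_def bij_betw_def inj_on_def by blast
qed

lemma gen_inj: "inj_on (gen T) {1..nrays T}"
  by (rule inj_onI, rule ray_inj[of _ _ 1]) simp_all

text \<open>The face generated by \<open>b\<close> alone is a one-dimensional cone of the fan, hence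
  one of the numbered rays. The factor is strictly positive because \<open>b\<close> is
  nonzero.\<close>

lemma fan_cone_ray:
  assumes "cone_gen B \<in> fan T" "independent B" "b \<in> B"
  obtains i t where "i \<in> {1..nrays T}" "0 < t" "b = t *\<^sub>R gen T i"
proof -
  have "cone_gen {b} \<in> fan T"
    using fan_faceD[OF assms(1)] cone_face_gen[OF assms(2), of "{b}"] assms(3) by simp
  moreover have "independent {b}" using assms by (meson empty_subsetI independent_mono insert_subset)
  then have "b \<noteq> 0" "dim (cone_gen {b}) = 1" by (auto simp: dim_cone_gen)
  ultimately have "cone_gen {b} \<in> (\<lambda>i. cone_gen {gen T i}) ` {1..nrays T}"
    using T unfolding fan_fundamental_triple_def bij_betw_def by auto
  then obtain i where i: "i \<in> {1..nrays T}" "cone_gen {b} = cone_gen {gen T i}" by auto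
  have "b \<in> cone_gen {gen T i}" using i(2) cone_gen_base[of "{b}" b] by auto
  then obtain t where "0 \<le> t" "b = t *\<^sub>R gen T i" unfolding cone_gen_singleton by auto
  with \<open>b \<noteq> 0\<close> i(1) that show ?thesis by (metis less_eq_real_def scaleR_zero_left)
qed

text \<open>Exchanges an arbitrary basis of \<delta> for the chosen generators that lie in \<delta>.
  In this description inclusions and intersections of cones become inclusions and intersections of
  index sets.\<close>

lemma fan_cone_rays:
  assumes "\<delta> \<in> fan T"
  defines "I \<equiv> {i \<in> {1..nrays T}. gen T i \<in> \<delta>}"
  shows "independent (gen T ` I)" and "\<delta> = cone_gen (gen T ` I)" and "card I = dim \<delta>"
proof -
  obtain B where B: "independent B" "\<delta> = cone_gen B" using fan_cone[OF assms(1)] .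
  have finB: "finite B" using B(1) by (rule independent_imp_finite)
  have ray: "\<forall>b\<in>B. \<exists>i t. i \<in> {1..nrays T} \<and> 0 < t \<and> b = t *\<^sub>R gen T i"
    using fan_cone_ray[of B] B assms(1) by blast
  then obtain r where "\<forall>b\<in>B. \<exists>t. r b \<in> {1..nrays T} \<and> 0 < t \<and> b = t *\<^sub>R gen T (r b)"
    using bchoice[OF ray] by blast
  then obtain t where rt: "\<forall>b\<in>B. r b \<in> {1..nrays T} \<and> 0 < t b \<and> b = t b *\<^sub>R gen T (r b)"
    using bchoice[of B "\<lambda>b t. r b \<in> {1..nrays T} \<and> 0 < t \<and> b = t *\<^sub>R gen T (r b)"] by blast
  have r: "r b \<in> {1..nrays T}" and t: "0 < t b" and bt: "b = t b *\<^sub>R gen T (r b)" if "b \<in> B" for b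
    using bspec[OF rt that] by blast+
  have gr: "gen T (r b) = (1 / t b) *\<^sub>R b" if "b \<in> B" for b
    using arg_cong[OF bt[OF that], of "\<lambda>x. (1 / t b) *\<^sub>R x"] t[OF that] by simp
  have rB: "r ` B \<subseteq> I"
    using r gr t cone_gen_scale[OF cone_gen_base[OF finB]] B(2) unfolding I_def
    by (auto simp: less_imp_le)
  have Ir: "I \<subseteq> r ` B"
  proof
    fix i assume "i \<in> I"
    then have i: "i \<in> {1..nrays T}" "gen T i \<in> \<delta>" unfolding I_def by auto
    have "cone_gen {gen T i} \<subseteq> \<delta>" using i(2) B(2) cone_gen_subset by blast
    then have "cone_gen {gen T i} \<inter> \<delta> = cone_gen {gen T i}" by auto
    \<comment> \<open>A ray contained in \<delta> equals its intersection with \<delta>, so the fan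
      axiom on intersections makes it a face of \<delta>.\<close>
    then have "cone_face (cone_gen {gen T i}) \<delta>"
      using fan_Int(2)[OF ray_in_fan(1)[OF i(1)] assms(1)] by simp
    then obtain B' C where C: "independent B'" "\<delta> = cone_gen B'" "C \<subseteq> B'"
      "cone_gen {gen T i} = cone_gen C"
      unfolding cone_face_def by auto
    have "independent C" using C independent_mono by blast
    then have "card C = 1" using dim_cone_gen ray_in_fan(2)[OF i(1)] C(4) by metis
    then obtain c where c: "C = {c}" by (auto simp: card_1_singleton_iff)
    then have "c \<in> cone_gen {gen T i}" using C(4) cone_gen_base[of C c] by simp
    moreover have "c \<noteq> 0" using \<open>independent C\<close> c by auto
    ultimately obtain s where s: "0 < s" "c = s *\<^sub>R gen T i"
      unfolding cone_gen_singleton by (auto simp: less_eq_real_def)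
    \<comment> \<open>The face relation came with its own basis \<open>B'\<close>, unrelated to
      \<open>B\<close>; uniqueness of ray generators up to scaling carries the ray over to
      \<open>B\<close>.\<close>
    obtain b u where b: "b \<in> B" "0 < u" "b = u *\<^sub>R c"
      using cone_gen_rays_unique[OF C(1) B(1)] C c B(2) by (metis insert_subset)
    have "gen T (r b) = (1 / t b * u * s) *\<^sub>R gen T i"
      using gr[OF b(1)] b(3) s(2) by simp
    moreover have "0 < 1 / t b * u * s" using t b s by simp
    ultimately have "r b = i" using ray_inj r b(1) i(1) by metis
    then show "i \<in> r ` B" using b(1) by blast
  qed
  have I: "I = r ` B" using rB Ir by auto
  show cone: "\<delta> = cone_gen (gen T ` I)"
  proof (rule subset_antisym)
    have "B \<subseteq> cone_gen (gen T ` I)"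
    proof
      fix b assume b: "b \<in> B"
      have "gen T (r b) \<in> cone_gen (gen T ` I)"
        using b I finB by (intro cone_gen_base) auto
      then show "b \<in> cone_gen (gen T ` I)"
        by (subst bt[OF b]) (rule cone_gen_scale, use t[OF b] in auto)
    qed
    then show "\<delta> \<subseteq> cone_gen (gen T ` I)" using B(2) cone_gen_subset by blast
    show "cone_gen (gen T ` I) \<subseteq> \<delta>"
      using B(2) by (simp only:) (rule cone_gen_subset, auto simp: I_def)
  qed
  have finI: "finite (gen T ` I)" unfolding I_def by auto
  have sp: "dim \<delta> = dim (span (gen T ` I))"
    by (metis cone dim_span finI span_cone_gen)
  have "card (gen T ` I) = card I"
    by (rule card_image) (rule inj_on_subset[OF gen_inj], auto simp: I_def)
  moreover have "card I \<le> card B" using I finB card_image_le by blast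
  moreover have "dim \<delta> = card B" using dim_cone_gen B by auto
  moreover have "dim (span (gen T ` I)) \<le> card (gen T ` I)"
    using finI dim_le_card'[OF finI] by simp
  \<comment> \<open>The chain dim \<delta> \<le> card I \<le> card B = dim \<delta> collapses; a
    spanning set of as many vectors as the dimension is independent.\<close>
  ultimately have cards: "card (gen T ` I) = card I" "card I = dim \<delta>" "card I = dim (span (gen T ` I))"
    using sp by linarith+
  then show "card I = dim \<delta>" by blast
  show "independent (gen T ` I)"
    by (rule card_le_dim_spanning[OF span_superset order_refl finI]) (use cards in linarith)
qed

lemma cone_idx_eq:
  assumes "\<delta> \<in> fan T" shows "cone_idx T \<delta> = {i \<in> {1..nrays T}. gen T i \<in> \<delta>}"
  unfolding cone_idx_def
proof (rule the_equality)
  note r = fan_cone_rays[OF assms]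
  show "{i \<in> {1..nrays T}. gen T i \<in> \<delta>} \<subseteq> {1..nrays T} \<and>
    card {i \<in> {1..nrays T}. gen T i \<in> \<delta>} = dim \<delta> \<and>
    \<delta> = cone_gen (gen T ` {i \<in> {1..nrays T}. gen T i \<in> \<delta>})"
    using r by auto
  fix I assume I: "I \<subseteq> {1..nrays T} \<and> card I = dim \<delta> \<and> \<delta> = cone_gen (gen T ` I)"
  then have "finite I" using finite_subset by auto
  then have "I \<subseteq> {i \<in> {1..nrays T}. gen T i \<in> \<delta>}"
    using I cone_gen_base[of "gen T ` I"] by auto
  then show "I = {i \<in> {1..nrays T}. gen T i \<in> \<delta>}"
    using I r(3) by (intro card_subset_eq) auto
qed

lemma cone_idx:
  assumes "\<delta> \<in> fan T"
  shows "finite (cone_idx T \<delta>)" "independent (gen T ` cone_idx T \<delta>)"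
    "inj_on (gen T) (cone_idx T \<delta>)" "\<delta> = cone_gen (gen T ` cone_idx T \<delta>)"
    "card (cone_idx T \<delta>) = dim \<delta>"
  unfolding cone_idx_eq[OF assms]
  by (use fan_cone_rays[OF assms] in \<open>simp_all\<close>) (rule inj_on_subset[OF gen_inj], auto)

lemma cone_idx_Int:
  assumes "\<delta> \<in> fan T" "\<gamma> \<in> fan T"
  shows "cone_idx T (\<delta> \<inter> \<gamma>) = cone_idx T \<delta> \<inter> cone_idx T \<gamma>"
  using assms fan_Int(3) by (auto simp: cone_idx_eq)

lemma cone_idx_mono:
  assumes "\<delta> \<in> fan T" "\<gamma> \<in> fan T" "\<delta> \<subseteq> \<gamma>"
  shows "cone_idx T \<delta> \<subseteq> cone_idx T \<gamma>"
  using assms by (auto simp: cone_idx_eq)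

end

section \<open>Maximal cones and dual bases\<close>

context
  fixes T :: "'n::finite fan_triple"
  assumes T: "fan_fundamental_triple T"
begin

context
  fixes \<sigma>
  assumes \<sigma>: "\<sigma> \<in> max_cones T"
begin

lemma max_cone_fan: "\<sigma> \<in> fan T"
  using \<sigma> unfolding max_cones_def by simp

lemma span_gen_max_cone: "span (gen T ` cone_idx T \<sigma>) = UNIV"
proof -
  note c = cone_idx[OF T max_cone_fan]
  have "card (gen T ` cone_idx T \<sigma>) = DIM(real^'n)"
    using c(3,5) \<sigma> unfolding max_cones_def by (simp add: card_image)
  then show ?thesis
    using card_ge_dim_independent[OF subset_UNIV c(2)] by auto
qed

lemma
  assumes i: "i \<in> cone_idx T \<sigma>"
  shows linear_dual_basis: "linear (dual_basis T \<sigma> i)"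
    and dual_basis_gen: "j \<in> cone_idx T \<sigma> \<Longrightarrow> dual_basis T \<sigma> i (gen T j) = (if j = i then 1 else 0)"
proof -
  note c = cone_idx[OF T max_cone_fan]
  let ?P = "\<lambda>\<alpha>. linear \<alpha> \<and> (\<forall>j\<in>cone_idx T \<sigma>. \<alpha> (gen T j) = (if j = i then 1 else (0::real)))"
  have "\<exists>!\<alpha>. ?P \<alpha>"
  proof (rule ex_ex1I)
    obtain \<alpha> where "linear \<alpha>"
      "\<forall>v\<in>gen T ` cone_idx T \<sigma>. \<alpha> v = (if v = gen T i then 1 else (0::real))"
      using linear_independent_extend[OF c(2), of "\<lambda>v. if v = gen T i then 1 else 0"] by auto
    \<comment> \<open>The extension theorem prescribes values on vectors, the dual basis on indices;
      injectivity of the numbering reconciles the two.\<close>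
    moreover have "gen T j = gen T i \<longleftrightarrow> j = i" if "j \<in> cone_idx T \<sigma>" for j
      using c(3) that i by (auto dest: inj_onD)
    ultimately show "\<exists>\<alpha>. ?P \<alpha>" by auto
    fix \<alpha> \<beta> assume a: "?P \<alpha>" and b: "?P \<beta>"
    then have "\<And>v. v \<in> gen T ` cone_idx T \<sigma> \<Longrightarrow> \<alpha> v = \<beta> v" by auto
    then show "\<alpha> = \<beta>"
      using a b linear_eq_on_span[of \<alpha> \<beta>] span_gen_max_cone by (metis UNIV_I ext)
  qed
  then have "?P (dual_basis T \<sigma> i)" unfolding dual_basis_def by (rule theI')
  then show "linear (dual_basis T \<sigma> i)"
    and "j \<in> cone_idx T \<sigma> \<Longrightarrow> dual_basis T \<sigma> i (gen T j) = (if j = i then 1 else 0)" by auto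
qed

lemma dual_basis_comb:
  assumes "i \<in> cone_idx T \<sigma>"
  shows "dual_basis T \<sigma> i (\<Sum>j\<in>cone_idx T \<sigma>. c j *\<^sub>R gen T j) = c i"
proof -
  have "dual_basis T \<sigma> i (\<Sum>j\<in>cone_idx T \<sigma>. c j *\<^sub>R gen T j)
      = (\<Sum>j\<in>cone_idx T \<sigma>. c j * (if j = i then 1 else 0))"
    using dual_basis_gen[OF assms] linear_dual_basis[OF assms]
    by (simp add: linear_sum linear_cmul)
  then show ?thesis
    using assms cone_idx(1)[OF T max_cone_fan] by (simp add: sum.delta if_distrib cong: if_cong)
qed

lemma dual_basis_expand: "(\<Sum>i\<in>cone_idx T \<sigma>. dual_basis T \<sigma> i v *\<^sub>R gen T i) = v"
proof -
  note c = cone_idx[OF T max_cone_fan]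
  have "v \<in> span (gen T ` cone_idx T \<sigma>)" using span_gen_max_cone by simp
  then obtain u where "v = (\<Sum>x\<in>gen T ` cone_idx T \<sigma>. u x *\<^sub>R x)"
    using span_finite[of "gen T ` cone_idx T \<sigma>"] c(1) by auto
  then have v: "v = (\<Sum>j\<in>cone_idx T \<sigma>. u (gen T j) *\<^sub>R gen T j)"
    using c(3) by (simp add: sum.reindex)
  have "dual_basis T \<sigma> i v = u (gen T i)" if "i \<in> cone_idx T \<sigma>" for i
    unfolding v using dual_basis_comb[OF that] .
  then show ?thesis using v by simp
qed

text \<open>The generators of a face are among those of \<sigma>, so an expansion over the face,
  padded with zeros, is the expansion over \<sigma>. All sign conditions on exponents come from
  here.\<close>

lemma dual_basis_face:
  assumes "\<delta> \<in> fan T" "\<delta> \<subseteq> \<sigma>" "v \<in> \<delta>" "i \<in> cone_idx T \<sigma>"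
  shows "0 \<le> dual_basis T \<sigma> i v" and "i \<notin> cone_idx T \<delta> \<Longrightarrow> dual_basis T \<sigma> i v = 0"
proof -
  note c = cone_idx[OF T assms(1)]
  have sub: "cone_idx T \<delta> \<subseteq> cone_idx T \<sigma>"
    using cone_idx_mono[OF T assms(1) max_cone_fan assms(2)] .
  have "v \<in> cone_gen (gen T ` cone_idx T \<delta>)" using c(4) assms(3) by simp
  then obtain u where u: "\<forall>b\<in>gen T ` cone_idx T \<delta>. 0 \<le> u b"
    and "v = (\<Sum>b\<in>gen T ` cone_idx T \<delta>. u b *\<^sub>R b)"
    unfolding cone_gen_def by blast
  then have "v = (\<Sum>j\<in>cone_idx T \<delta>. u (gen T j) *\<^sub>R gen T j)"
    using c(3) by (simp add: sum.reindex)
  also have "\<dots> = (\<Sum>j\<in>cone_idx T \<sigma>. (if j \<in> cone_idx T \<delta> then u (gen T j) else 0) *\<^sub>R gen T j)"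
    using sub cone_idx(1)[OF T max_cone_fan] by (intro sum.mono_neutral_cong_left) auto
  finally have "dual_basis T \<sigma> i v = (if i \<in> cone_idx T \<delta> then u (gen T i) else 0)"
    using dual_basis_comb[OF assms(4)] by simp
  then show "0 \<le> dual_basis T \<sigma> i v" "i \<notin> cone_idx T \<delta> \<Longrightarrow> dual_basis T \<sigma> i v = 0"
    using u by auto
qed

text \<open>The dual functionals read off the coefficients of the unique expansion in the
  generators. Its purpose is closedness of the cone.\<close>

lemma max_cone_halfspaces: "\<sigma> = (\<Inter>i\<in>cone_idx T \<sigma>. {x. 0 \<le> dual_basis T \<sigma> i x})"
proof (intro subset_antisym subsetI)
  fix x assume "x \<in> \<sigma>"
  then show "x \<in> (\<Inter>i\<in>cone_idx T \<sigma>. {x. 0 \<le> dual_basis T \<sigma> i x})"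
    using dual_basis_face(1)[OF max_cone_fan] by auto
next
  fix x assume x: "x \<in> (\<Inter>i\<in>cone_idx T \<sigma>. {x. 0 \<le> dual_basis T \<sigma> i x})"
  note c = cone_idx[OF T max_cone_fan]
  have "(\<Sum>i\<in>cone_idx T \<sigma>. dual_basis T \<sigma> i x *\<^sub>R gen T i) \<in> cone_gen (gen T ` cone_idx T \<sigma>)"
    using x c(1) by (intro cone_gen_sum cone_gen_base) auto
  then show "x \<in> \<sigma>" using c(4) dual_basis_expand by simp
qed

lemma closed_max_cone: "closed \<sigma>"
proof -
  have "continuous_on UNIV (dual_basis T \<sigma> i)" if "i \<in> cone_idx T \<sigma>" for i
    using linear_dual_basis[OF that] by (simp add: linear_continuous_on linear_linear)
  then have "closed (\<Inter>i\<in>cone_idx T \<sigma>. {x. 0 \<le> dual_basis T \<sigma> i x})"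
    by (intro closed_INT ballI closed_Collect_le continuous_on_const) auto
  then show ?thesis using max_cone_halfspaces by simp
qed

end

text \<open>The lower-dimensional cones form a null set, so the closed union of the maximal cones is dense
  in the interior of the support.\<close>
lemma max_cones_cover:
  assumes "convex (fan_support T)" and "aff_dim (fan_support T) = int CARD('n)"
  shows "fan_support T \<subseteq> \<Union>(max_cones T)"
proof -
  let ?S = "fan_support T"
  let ?U = "\<Union>(fan T - max_cones T)"
  have fin: "finite (fan T)"
    using T unfolding fan_fundamental_triple_def simplicial_fan_def by blast
  have "negligible \<tau>" if "\<tau> \<in> fan T - max_cones T" for \<tau>
    using that dim_subset_UNIV[of \<tau>] unfolding max_cones_def
    by (intro negligible_lowdim) auto
  then have neg: "negligible ?U" using fin by (intro negligible_Union) auto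
  have closed: "closed (\<Union>(max_cones T))"
    using fin closed_max_cone by (intro closed_Union) (auto simp: max_cones_def)
  have "interior ?S \<noteq> {}"
    using assms interior_rel_interior_gen[of ?S] rel_interior_eq_empty[OF assms(1)]
    by (auto simp: aff_dim_empty)
  have "interior ?S \<subseteq> closure (\<Union>(max_cones T))"
  proof
    fix x assume x: "x \<in> interior ?S"
    show "x \<in> closure (\<Union>(max_cones T))"
      unfolding closure_iff_nhds_not_empty
    proof (intro allI impI)
      fix A V assume V: "V \<subseteq> A" "open V" "x \<in> V"
      have "\<not> V \<inter> interior ?S \<subseteq> ?U"
        using open_not_negligible[of "V \<inter> interior ?S"] negligible_subset[OF neg] V x by blast
      then obtain y where "y \<in> V" "y \<in> ?S" "y \<notin> ?U" using interior_subset by blast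
      then show "\<Union>(max_cones T) \<inter> A \<noteq> {}" using V unfolding fan_support_def by blast
    qed
  qed
  then have "closure (interior ?S) \<subseteq> \<Union>(max_cones T)"
    using closed by (metis closure_closed closure_minimal)
  \<comment> \<open>A convex set with nonempty interior lies in the closure of that interior.
    Without convexity, lower-dimensional cones could stick out of it.\<close>
  then show ?thesis
    using convex_closure_interior[OF assms(1) \<open>interior ?S \<noteq> {}\<close>] closure_subset by blast
qed

text \<open>A maximal cone that contains a relative interior point of \<delta> meets \<delta> in a
  face through that point, and only \<delta> itself is such a face.\<close>

lemma fan_cone_in_max_cone:
  assumes "convex (fan_support T)" and "aff_dim (fan_support T) = int CARD('n)"
    and \<delta>: "\<delta> \<in> fan T"
  obtains \<sigma> where "\<sigma> \<in> max_cones T" "cone_face \<delta> \<sigma>"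
proof -
  note c = cone_idx[OF T \<delta>]
  \<comment> \<open>The sum of the generators has all coefficients positive, which puts it in the
    relative interior of \<delta>.\<close>
  let ?x = "\<Sum>i\<in>cone_idx T \<delta>. 1 *\<^sub>R gen T i"
  have x: "?x \<in> \<delta>"
    by (subst (2) c(4)) (use c(1) in \<open>intro cone_gen_sum cone_gen_base; simp\<close>)
  then have "?x \<in> fan_support T" using \<delta> unfolding fan_support_def by blast
  then obtain \<sigma> where \<sigma>: "\<sigma> \<in> max_cones T" "?x \<in> \<sigma>"
    using max_cones_cover[OF assms(1,2)] by blast
  note \<sigma>f = max_cone_fan[OF \<sigma>(1)]
  let ?J = "cone_idx T (\<delta> \<inter> \<sigma>)"
  note cJ = cone_idx[OF T fan_Int(3)[OF T \<delta> \<sigma>f]]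
  have sub: "?J \<subseteq> cone_idx T \<delta>" using cone_idx_Int[OF T \<delta> \<sigma>f] by simp
  have "?x \<in> cone_gen (gen T ` ?J)" using x \<sigma>(2) cJ(4) by auto
  then obtain u where "?x = (\<Sum>b\<in>gen T ` ?J. u b *\<^sub>R b)"
    unfolding cone_gen_def by blast
  also have "\<dots> = (\<Sum>b\<in>gen T ` cone_idx T \<delta>. (if b \<in> gen T ` ?J then u b else 0) *\<^sub>R b)"
    using sub c(1) by (intro sum.mono_neutral_cong_left) auto
  finally have "(\<Sum>b\<in>gen T ` cone_idx T \<delta>. 1 *\<^sub>R b)
      = (\<Sum>b\<in>gen T ` cone_idx T \<delta>. (if b \<in> gen T ` ?J then u b else 0) *\<^sub>R b)"
    using c(3) by (simp add: sum.reindex)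
  \<comment> \<open>A generator missing from the intersection would have coefficient 1 on the left
    and 0 on the right.\<close>
  then have "b \<in> gen T ` ?J" if "b \<in> gen T ` cone_idx T \<delta>" for b
    using independent_coeff_unique[OF c(2) _ that, of "\<lambda>_. 1" "\<lambda>b. if b \<in> gen T ` ?J then u b else 0"]
    by (auto split: if_splits)
  then have "gen T ` ?J = gen T ` cone_idx T \<delta>" using sub by blast
  then have "\<delta> \<inter> \<sigma> = \<delta>" using c(4) cJ(4) by metis
  then show ?thesis using that[OF \<sigma>(1)] fan_Int(2)[OF T \<delta> \<sigma>f] by simp
qed

end

section \<open>Orbits of the affine charts\<close>

lemma e2pi_add: "e2pi (a + b) = e2pi a * e2pi b"
  unfolding e2pi_def by (simp add: distrib_left exp_add)

lemma e2pi_0 [simp]: "e2pi 0 = 1"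
  unfolding e2pi_def by simp

lemma e2pi_nonzero [simp]: "e2pi a \<noteq> 0"
  unfolding e2pi_def by simp

lemma e2pi_sum: "finite A \<Longrightarrow> e2pi (\<Sum>a\<in>A. g a) = (\<Prod>a\<in>A. e2pi (g a))"
  by (induction A rule: finite_induct) (auto simp: e2pi_add)

lemma e2pi_eqD:
  assumes "e2pi a = e2pi b" obtains n :: int where "a = b + of_int n"
proof -
  obtain n :: int where "2 * of_real pi * \<i> * a = 2 * of_real pi * \<i> * b + (of_int (2 * n) * pi) * \<i>"
    using assms unfolding e2pi_def exp_eq by blast
  then have "(2 * of_real pi * \<i>) * a = (2 * of_real pi * \<i>) * (b + of_int n)"
    by (simp add: algebra_simps)
  then have "a = b + of_int n" by simp
  then show ?thesis by (rule that)
qed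

lemma e2pi_surj:
  assumes "z \<noteq> 0" shows "\<exists>x. z = e2pi x"
proof
  show "z = e2pi (Ln z / (2 * of_real pi * \<i>))"
    using assms unfolding e2pi_def by (simp add: exp_Ln)
qed

lemma e2pi_surj_on: "\<exists>x. \<forall>k\<in>I. z k \<noteq> 0 \<longrightarrow> z k = e2pi (x k)"
  by (rule bchoice) (use e2pi_surj in blast)

section \<open>Quasilattices as additive groups\<close>

lemma int_span_0: "0 \<in> int_span S"
  unfolding int_span_def by (auto intro!: exI[of _ "{}"])

lemma int_span_add:
  assumes "a \<in> int_span S" "b \<in> int_span S" shows "a + b \<in> int_span S"
proof -
  obtain F c G d where F: "finite F" "F \<subseteq> S" "a = (\<Sum>s\<in>F. of_int (c s) *\<^sub>R s)"
    and G: "finite G" "G \<subseteq> S" "b = (\<Sum>s\<in>G. of_int (d s) *\<^sub>R s)"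
    using assms unfolding int_span_def by blast
  define e where "e s = (if s \<in> F then c s else 0) + (if s \<in> G then d s else 0)" for s
  have "a = (\<Sum>s\<in>F \<union> G. of_int (if s \<in> F then c s else 0) *\<^sub>R s)"
    unfolding F(3) using F G by (intro sum.mono_neutral_cong_left) auto
  moreover have "b = (\<Sum>s\<in>F \<union> G. of_int (if s \<in> G then d s else 0) *\<^sub>R s)"
    unfolding G(3) using F G by (intro sum.mono_neutral_cong_left) auto
  ultimately have "a + b = (\<Sum>s\<in>F \<union> G. of_int (e s) *\<^sub>R s)"
    unfolding e_def by (simp add: scaleR_add_left sum.distrib)
  then show ?thesis unfolding int_span_def mem_Collect_eq
    by (intro exI[of _ "F \<union> G"] exI[of _ e]) (use F G in auto)
qed

lemma int_span_scale:
  assumes "a \<in> int_span S" shows "of_int n *\<^sub>R a \<in> int_span S"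
proof -
  obtain F c where F: "finite F" "F \<subseteq> S" "a = (\<Sum>s\<in>F. of_int (c s) *\<^sub>R s)"
    using assms unfolding int_span_def by blast
  have "of_int n *\<^sub>R a = (\<Sum>s\<in>F. of_int (n * c s) *\<^sub>R s)"
    unfolding F(3) by (simp add: scaleR_sum_right)
  then show ?thesis unfolding int_span_def mem_Collect_eq
    by (intro exI[of _ F] exI[of _ "\<lambda>s. n * c s"]) (use F in auto)
qed

context
  fixes T :: "'n::finite fan_triple"
  assumes T: "fan_fundamental_triple T"
begin

lemma
  shows qlat_0: "0 \<in> qlat T"
    and qlat_add: "a \<in> qlat T \<Longrightarrow> b \<in> qlat T \<Longrightarrow> a + b \<in> qlat T"
    and qlat_scale: "a \<in> qlat T \<Longrightarrow> of_int n *\<^sub>R a \<in> qlat T"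
proof -
  obtain S where "qlat T = int_span S"
    using T unfolding fan_fundamental_triple_def quasilattice_def by blast
  then show "0 \<in> qlat T" "a \<in> qlat T \<Longrightarrow> b \<in> qlat T \<Longrightarrow> a + b \<in> qlat T"
    "a \<in> qlat T \<Longrightarrow> of_int n *\<^sub>R a \<in> qlat T"
    by (simp_all add: int_span_0 int_span_add int_span_scale)
qed

lemma qlat_uminus: "a \<in> qlat T \<Longrightarrow> - a \<in> qlat T"
  using qlat_scale[of a "-1"] by simp

lemma qlat_sum:
  "finite A \<Longrightarrow> (\<And>a. a \<in> A \<Longrightarrow> g a \<in> qlat T) \<Longrightarrow> (\<Sum>a\<in>A. of_int (n a) *\<^sub>R g a) \<in> qlat T"
  by (induction A rule: finite_induct) (auto intro: qlat_0 qlat_add qlat_scale)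

lemma gen_in_qlat: "\<sigma> \<in> fan T \<Longrightarrow> i \<in> cone_idx T \<sigma> \<Longrightarrow> gen T i \<in> qlat T"
  using T unfolding fan_fundamental_triple_def by (auto simp: cone_idx_eq[OF T])

end

lemma cfunctional_add:
  "linear \<alpha> \<Longrightarrow> cfunctional \<alpha> (u + (\<chi> k. of_real (q $ k))) = cfunctional \<alpha> u + of_real (\<alpha> q)"
proof -
  assume "linear \<alpha>"
  moreover have "(\<chi> k. Re ((u + (\<chi> k. of_real (q $ k))) $ k)) = (\<chi> k. Re (u $ k)) + q"
    and "(\<chi> k. Im ((u + (\<chi> k. of_real (q $ k))) $ k)) = (\<chi> k. Im (u $ k))"
    by (auto simp: vec_eq_iff)
  ultimately show ?thesis
    unfolding cfunctional_def by (simp add: linear_add complex_eq_iff)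
qed

text \<open>Both actions on a chart are of this form: that of Q with \<open>c\<close> given by
  \<open>dual_real\<close>, that of the complex torus with \<open>c\<close> given by
  \<open>dual_complex\<close>. Since \<open>c\<close> is additive under composition, they commute
  with each other at no cost.\<close>

definition twist ::
  "'n::finite fan_triple \<Rightarrow> (real^'n) set \<Rightarrow> (nat \<Rightarrow> complex) \<Rightarrow> (nat \<Rightarrow> complex) \<Rightarrow> nat \<Rightarrow> complex" where
  "twist T \<sigma> c z = (\<lambda>i\<in>cone_idx T \<sigma>. e2pi (c i) * z i)"

definition orb ::
  "'n::finite fan_triple \<Rightarrow> (real^'n) set \<Rightarrow> (nat \<Rightarrow> complex) \<Rightarrow> (nat \<Rightarrow> complex) set" where
  "orb T \<sigma> z = orbit_rel T \<sigma> `` {z}"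

definition dual_real :: "'n::finite fan_triple \<Rightarrow> (real^'n) set \<Rightarrow> real^'n \<Rightarrow> nat \<Rightarrow> complex" where
  "dual_real T \<sigma> q = (\<lambda>i. of_real (dual_basis T \<sigma> i q))"

definition dual_complex :: "'n::finite fan_triple \<Rightarrow> (real^'n) set \<Rightarrow> complex^'n \<Rightarrow> nat \<Rightarrow> complex" where
  "dual_complex T \<sigma> u = (\<lambda>i. cfunctional (dual_basis T \<sigma> i) u)"

lemma twist_PiE [simp]: "twist T \<sigma> c z \<in> cone_idx T \<sigma> \<rightarrow>\<^sub>E UNIV"
  unfolding twist_def by auto

lemma twist_twist: "twist T \<sigma> c (twist T \<sigma> d z) = twist T \<sigma> (\<lambda>i. c i + d i) z"
  unfolding twist_def by (auto simp: e2pi_add restrict_def)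

lemma twist_0: "z \<in> cone_idx T \<sigma> \<rightarrow>\<^sub>E UNIV \<Longrightarrow> twist T \<sigma> (\<lambda>_. 0) z = z"
  unfolding twist_def by (auto simp: restrict_def PiE_def extensional_def)

lemma twist_cong: "(\<And>i. i \<in> cone_idx T \<sigma> \<Longrightarrow> c i = d i) \<Longrightarrow> twist T \<sigma> c z = twist T \<sigma> d z"
  unfolding twist_def by auto

lemma orbit_rel_iff:
  "(z, w) \<in> orbit_rel T \<sigma> \<longleftrightarrow>
    z \<in> cone_idx T \<sigma> \<rightarrow>\<^sub>E UNIV \<and> (\<exists>q\<in>qlat T. w = twist T \<sigma> (dual_real T \<sigma> q) z)"
  unfolding orbit_rel_def twist_def dual_real_def by auto

lemma twist_affine_open:
  "z \<in> affine_open T \<sigma> \<delta> \<Longrightarrow> twist T \<sigma> c z \<in> affine_open T \<sigma> \<delta>"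
  unfolding affine_open_def twist_def by auto

lemma orb_iff:
  "w \<in> orb T \<sigma> z \<longleftrightarrow>
    z \<in> cone_idx T \<sigma> \<rightarrow>\<^sub>E UNIV \<and> (\<exists>q\<in>qlat T. w = twist T \<sigma> (dual_real T \<sigma> q) z)"
  unfolding orb_def by (simp only: Image_singleton_iff orbit_rel_iff)

lemma affine_piece_iff: "y \<in> affine_piece T \<sigma> \<delta> \<longleftrightarrow> (\<exists>z\<in>affine_open T \<sigma> \<delta>. y = orb T \<sigma> z)"
  unfolding affine_piece_def quotient_def orb_def by blast

lemma affine_open_PiE: "z \<in> affine_open T \<sigma> \<delta> \<Longrightarrow> z \<in> cone_idx T \<sigma> \<rightarrow>\<^sub>E UNIV"
  unfolding affine_open_def by blast

context
  fixes T :: "'n::finite fan_triple" and \<sigma>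
  assumes T: "fan_fundamental_triple T" and \<sigma>: "\<sigma> \<in> max_cones T"
begin

lemma dual_real_add:
  "twist T \<sigma> (dual_real T \<sigma> a) (twist T \<sigma> (dual_real T \<sigma> b) z) = twist T \<sigma> (dual_real T \<sigma> (a + b)) z"
  unfolding twist_twist
  by (rule twist_cong) (simp add: dual_real_def linear_add[OF linear_dual_basis[OF T \<sigma>]])

lemma dual_real_0: "i \<in> cone_idx T \<sigma> \<Longrightarrow> dual_real T \<sigma> 0 i = 0"
  by (simp add: dual_real_def linear_0[OF linear_dual_basis[OF T \<sigma>]])

lemma equiv_orbit_rel: "equiv (cone_idx T \<sigma> \<rightarrow>\<^sub>E UNIV) (orbit_rel T \<sigma>)"
proof (rule equivI)
  show "orbit_rel T \<sigma> \<subseteq> (cone_idx T \<sigma> \<rightarrow>\<^sub>E UNIV) \<times> (cone_idx T \<sigma> \<rightarrow>\<^sub>E UNIV)"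
  proof (rule subrelI)
    fix z w assume "(z, w) \<in> orbit_rel T \<sigma>"
    then obtain q where "z \<in> cone_idx T \<sigma> \<rightarrow>\<^sub>E UNIV" "w = twist T \<sigma> (dual_real T \<sigma> q) z"
      unfolding orbit_rel_iff by blast
    then show "(z, w) \<in> (cone_idx T \<sigma> \<rightarrow>\<^sub>E UNIV) \<times> (cone_idx T \<sigma> \<rightarrow>\<^sub>E UNIV)"
      using twist_PiE[of T \<sigma>] by simp
  qed
  have tw0: "twist T \<sigma> (dual_real T \<sigma> 0) z = z" if "z \<in> cone_idx T \<sigma> \<rightarrow>\<^sub>E UNIV" for z
    by (subst twist_cong[OF dual_real_0]) (auto intro: twist_0[OF that])
  then show "refl_on (cone_idx T \<sigma> \<rightarrow>\<^sub>E UNIV) (orbit_rel T \<sigma>)"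
    by (intro refl_onI, unfold orbit_rel_iff) (metis qlat_0[OF T])
  show "sym (orbit_rel T \<sigma>)"
  proof (rule symI)
    fix z w assume "(z, w) \<in> orbit_rel T \<sigma>"
    then obtain q where q: "z \<in> cone_idx T \<sigma> \<rightarrow>\<^sub>E UNIV" "q \<in> qlat T" "w = twist T \<sigma> (dual_real T \<sigma> q) z"
      unfolding orbit_rel_iff by blast
    have "twist T \<sigma> (dual_real T \<sigma> (- q)) w = twist T \<sigma> (dual_real T \<sigma> 0) z"
      unfolding q(3) dual_real_add by simp
    also have "\<dots> = z" by (rule tw0[OF q(1)])
    finally have "z = twist T \<sigma> (dual_real T \<sigma> (- q)) w" by (rule sym)
    then show "(w, z) \<in> orbit_rel T \<sigma>"
      unfolding orbit_rel_iff
      by (intro conjI bexI[of _ "- q"] qlat_uminus[OF T] q(2)) (simp_all only: q(3) twist_PiE)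
  qed
  show "trans (orbit_rel T \<sigma>)"
  proof (rule transI)
    fix z w v assume "(z, w) \<in> orbit_rel T \<sigma>" "(w, v) \<in> orbit_rel T \<sigma>"
    then obtain q r where qr: "q \<in> qlat T" "w = twist T \<sigma> (dual_real T \<sigma> q) z"
      "r \<in> qlat T" "v = twist T \<sigma> (dual_real T \<sigma> r) w" and z: "z \<in> cone_idx T \<sigma> \<rightarrow>\<^sub>E UNIV"
      unfolding orbit_rel_iff by blast
    then have "v = twist T \<sigma> (dual_real T \<sigma> (r + q)) z" using dual_real_add by simp
    then show "(z, v) \<in> orbit_rel T \<sigma>"
      unfolding orbit_rel_iff using qlat_add[OF T qr(3,1)] z by blast
  qed
qed

lemma orb_self: "z \<in> cone_idx T \<sigma> \<rightarrow>\<^sub>E UNIV \<Longrightarrow> z \<in> orb T \<sigma> z"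
  unfolding orb_def by (rule equiv_class_self[OF equiv_orbit_rel])

lemma orb_twist:
  "q \<in> qlat T \<Longrightarrow> z \<in> cone_idx T \<sigma> \<rightarrow>\<^sub>E UNIV \<Longrightarrow> orb T \<sigma> (twist T \<sigma> (dual_real T \<sigma> q) z) = orb T \<sigma> z"
  unfolding orb_def
  by (rule equiv_class_eq[OF equiv_orbit_rel, symmetric]) (auto simp only: orbit_rel_iff)

text \<open>Twisting never creates or removes a zero, so a whole orbit lies in the open set as soon
  as one of its points does. Membership in a piece can therefore be tested on any
  representative.\<close>

lemma orb_affine_pieceD:
  assumes "orb T \<sigma> z \<in> affine_piece T \<sigma> \<delta>" and "z \<in> cone_idx T \<sigma> \<rightarrow>\<^sub>E UNIV"
  shows "z \<in> affine_open T \<sigma> \<delta>"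
proof -
  obtain w where w: "w \<in> affine_open T \<sigma> \<delta>" "orb T \<sigma> z = orb T \<sigma> w"
    using assms(1) affine_piece_iff by blast
  then have "z \<in> orb T \<sigma> w" using orb_self[OF assms(2)] by simp
  then obtain q where "z = twist T \<sigma> (dual_real T \<sigma> q) w" unfolding orb_iff by blast
  then show ?thesis using twist_affine_open[OF w(1)] by simp
qed

text \<open>Passing to quotients need not commute with intersections; here it does because the open
  sets are unions of orbits. Transitivity of gluing rests on it.\<close>

lemma affine_piece_Int:
  assumes "\<delta> \<in> fan T" "\<gamma> \<in> fan T"
  shows "affine_piece T \<sigma> (\<delta> \<inter> \<gamma>) = affine_piece T \<sigma> \<delta> \<inter> affine_piece T \<sigma> \<gamma>"
proof -
  have "affine_open T \<sigma> (\<delta> \<inter> \<gamma>) = affine_open T \<sigma> \<delta> \<inter> affine_open T \<sigma> \<gamma>"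
    unfolding affine_open_def cone_idx_Int[OF T assms] by auto
  then have iff: "z \<in> affine_open T \<sigma> (\<delta> \<inter> \<gamma>) \<longleftrightarrow> z \<in> affine_open T \<sigma> \<delta> \<and> z \<in> affine_open T \<sigma> \<gamma>" for z
    by (simp only: Int_iff)
  show ?thesis
  proof (intro subset_antisym subsetI)
    fix y assume "y \<in> affine_piece T \<sigma> (\<delta> \<inter> \<gamma>)"
    then obtain z where "z \<in> affine_open T \<sigma> (\<delta> \<inter> \<gamma>)" "y = orb T \<sigma> z"
      unfolding affine_piece_iff by (rule bexE)
    then show "y \<in> affine_piece T \<sigma> \<delta> \<inter> affine_piece T \<sigma> \<gamma>"
      by (auto simp: affine_piece_iff iff)
  next
    fix y assume "y \<in> affine_piece T \<sigma> \<delta> \<inter> affine_piece T \<sigma> \<gamma>"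
    then have y: "y \<in> affine_piece T \<sigma> \<delta>" "y \<in> affine_piece T \<sigma> \<gamma>" by simp_all
    obtain z where z: "z \<in> affine_open T \<sigma> \<delta>" "y = orb T \<sigma> z"
      using y(1) unfolding affine_piece_iff by (rule bexE)
    have "z \<in> affine_open T \<sigma> \<gamma>"
      using y(2) affine_open_PiE[OF z(1)] unfolding z(2) by (rule orb_affine_pieceD)
    then have "z \<in> affine_open T \<sigma> (\<delta> \<inter> \<gamma>)" using z(1) iff by simp
    then show "y \<in> affine_piece T \<sigma> (\<delta> \<inter> \<gamma>)"
      unfolding affine_piece_iff z(2) by (intro bexI[of _ z]) simp_all
  qed
qed

lemma affine_pieceE:
  assumes "y \<in> affine_piece T \<sigma> \<delta>"
  obtains z where "z \<in> affine_open T \<sigma> \<delta>" "z \<in> cone_idx T \<sigma> \<rightarrow>\<^sub>E UNIV" "y = orb T \<sigma> z"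
proof -
  obtain z where z: "z \<in> affine_open T \<sigma> \<delta>" "y = orb T \<sigma> z"
    using assms unfolding affine_piece_iff by (rule bexE)
  show ?thesis by (rule that[OF z(1) affine_open_PiE[OF z(1)] z(2)])
qed

text \<open>Another representative differs by a twist from Q, and twists commute, so all results lie
  in one orbit.\<close>

lemma piece_act_orb:
  assumes "z \<in> cone_idx T \<sigma> \<rightarrow>\<^sub>E UNIV"
  shows "piece_act T \<sigma> u (orb T \<sigma> z) = orb T \<sigma> (twist T \<sigma> (dual_complex T \<sigma> u) z)"
proof -
  have "orb T \<sigma> (twist T \<sigma> (dual_complex T \<sigma> u) w) = orb T \<sigma> (twist T \<sigma> (dual_complex T \<sigma> u) z)"
    if w: "w \<in> orb T \<sigma> z" for w
  proof -
    obtain q where q: "q \<in> qlat T" "w = twist T \<sigma> (dual_real T \<sigma> q) z"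
      using w unfolding orb_iff by (elim conjE bexE)
    have "twist T \<sigma> (dual_complex T \<sigma> u) w = twist T \<sigma> (dual_real T \<sigma> q) (twist T \<sigma> (dual_complex T \<sigma> u) z)"
      unfolding q(2) twist_twist by (simp only: add.commute)
    then show ?thesis using orb_twist[OF q(1) twist_PiE] by simp
  qed
  moreover have "piece_act T \<sigma> u (orb T \<sigma> z) =
      (\<Union>w\<in>orb T \<sigma> z. orb T \<sigma> (twist T \<sigma> (dual_complex T \<sigma> u) w))"
    unfolding piece_act_def orb_def twist_def dual_complex_def ..
  ultimately show ?thesis using orb_self[OF assms] by blast
qed

text \<open>A shift by a lattice vector acts as an element of Q, which is trivial on orbits. Hence
  the action depends only on the class of \<open>u\<close> in the quasitorus.\<close>

lemma piece_act_shift: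
  assumes "q \<in> qlat T" "y \<in> affine_piece T \<sigma> \<delta>"
  shows "piece_act T \<sigma> (u + (\<chi> k. of_real (q $ k))) y = piece_act T \<sigma> u y"
proof -
  obtain z where z: "z \<in> cone_idx T \<sigma> \<rightarrow>\<^sub>E UNIV" "y = orb T \<sigma> z" using assms(2) by (rule affine_pieceE)
  have shift: "twist T \<sigma> (dual_complex T \<sigma> (u + (\<chi> k. of_real (q $ k)))) z =
      twist T \<sigma> (dual_real T \<sigma> q) (twist T \<sigma> (dual_complex T \<sigma> u) z)"
    unfolding twist_twist
    by (rule twist_cong) (simp add: dual_real_def dual_complex_def cfunctional_add[OF linear_dual_basis[OF T \<sigma>]])
  show ?thesis
    unfolding z(2) piece_act_orb[OF z(1)] shift by (rule orb_twist[OF assms(1) twist_PiE])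
qed

lemma piece_act_affine_piece:
  assumes "y \<in> affine_piece T \<sigma> \<delta>" shows "piece_act T \<sigma> u y \<in> affine_piece T \<sigma> \<delta>"
proof -
  obtain z where z: "z \<in> affine_open T \<sigma> \<delta>" "z \<in> cone_idx T \<sigma> \<rightarrow>\<^sub>E UNIV" "y = orb T \<sigma> z"
    using assms by (rule affine_pieceE)
  show ?thesis
    unfolding z(3) piece_act_orb[OF z(2)] affine_piece_iff
    by (rule bexI[rotated], rule twist_affine_open[OF z(1)]) (rule refl)
qed

end

section \<open>Affine toric morphisms\<close>

lemma e2pi_of_int: "e2pi (of_int n) = 1"
  unfolding e2pi_def exp_eq_1 by (auto simp: mult.commute mult.left_commute intro!: exI[of _ n])

text \<open>With \<open>k\<close> an index of the source cone this is the entry in row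
  \<open>j\<close> and column \<open>k\<close> of the matrix of \<open>f\<close> in the bases of
  chosen generators; composing morphisms will multiply these matrices.\<close>

definition toric_exponent ::
  "'n::finite fan_triple \<Rightarrow> 'm::finite fan_triple \<Rightarrow> (real^'n \<Rightarrow> real^'m) \<Rightarrow> (real^'m) set \<Rightarrow>
     nat \<Rightarrow> nat \<Rightarrow> real" where
  "toric_exponent T\<^sub>1 T\<^sub>2 f \<sigma>\<^sub>2 j k = dual_basis T\<^sub>2 \<sigma>\<^sub>2 j (f (gen T\<^sub>1 k))"

definition toric_monomials ::
  "'n::finite fan_triple \<Rightarrow> 'm::finite fan_triple \<Rightarrow> (real^'n \<Rightarrow> real^'m) \<Rightarrow>
     (real^'n) set \<Rightarrow> (real^'m) set \<Rightarrow> (nat \<Rightarrow> complex) \<Rightarrow> (nat \<Rightarrow> complex) \<Rightarrow> nat \<Rightarrow> complex" where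
  "toric_monomials T\<^sub>1 T\<^sub>2 f \<sigma>\<^sub>1 \<sigma>\<^sub>2 z x = (\<lambda>j\<in>cone_idx T\<^sub>2 \<sigma>\<^sub>2.
     \<Prod>k\<in>cone_idx T\<^sub>1 \<sigma>\<^sub>1. real_pow (z k) (x k) (toric_exponent T\<^sub>1 T\<^sub>2 f \<sigma>\<^sub>2 j k))"

text \<open>At a vanishing coordinate \<open>x k\<close> is left arbitrary; \<open>real_pow\<close>
  does not look at it there.\<close>

definition logs :: "nat set \<Rightarrow> (nat \<Rightarrow> complex) \<Rightarrow> (nat \<Rightarrow> complex) set" where
  "logs I z = {x. \<forall>k\<in>I. z k \<noteq> 0 \<longrightarrow> z k = e2pi (x k)}"

lemma logs_nonempty: "\<exists>x. x \<in> logs I z"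
  unfolding logs_def using e2pi_surj_on by blast

lemma affine_toric_map_alt:
  "affine_toric_map T\<^sub>1 T\<^sub>2 f \<sigma>\<^sub>1 \<sigma>\<^sub>2 y =
    (\<Union>z\<in>y. \<Union>x\<in>logs (cone_idx T\<^sub>1 \<sigma>\<^sub>1) z. orb T\<^sub>2 \<sigma>\<^sub>2 (toric_monomials T\<^sub>1 T\<^sub>2 f \<sigma>\<^sub>1 \<sigma>\<^sub>2 z x))"
  unfolding affine_toric_map_def logs_def orb_def toric_monomials_def toric_exponent_def ..

lemma toric_monomials_PiE:
  "toric_monomials T\<^sub>1 T\<^sub>2 f \<sigma>\<^sub>1 \<sigma>\<^sub>2 z x \<in> cone_idx T\<^sub>2 \<sigma>\<^sub>2 \<rightarrow>\<^sub>E UNIV"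
  unfolding toric_monomials_def by auto

lemma prod_real_pow:
  assumes "finite I"
  shows "(\<Prod>k\<in>I. real_pow (z k) (x k) (a k)) =
    (if \<exists>k\<in>I. z k = 0 \<and> a k \<noteq> 0 then 0 else e2pi (\<Sum>k\<in>I. if z k = 0 then 0 else of_real (a k) * x k))"
proof (cases "\<exists>k\<in>I. z k = 0 \<and> a k \<noteq> 0")
  case True
  then have "(\<Prod>k\<in>I. real_pow (z k) (x k) (a k)) = 0"
    using assms unfolding real_pow_def by (intro prod_zero) auto
  then show ?thesis using True by simp
next
  case False
  then have "(\<Prod>k\<in>I. real_pow (z k) (x k) (a k)) =
      (\<Prod>k\<in>I. e2pi (if z k = 0 then 0 else of_real (a k) * x k))"
    unfolding real_pow_def by (intro prod.cong) auto
  then show ?thesis by (simp only: False if_False e2pi_sum[OF assms])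
qed

lemma toric_monomials_eq_0_iff:
  assumes "finite (cone_idx T\<^sub>1 \<sigma>\<^sub>1)" and "j \<in> cone_idx T\<^sub>2 \<sigma>\<^sub>2"
  shows "toric_monomials T\<^sub>1 T\<^sub>2 f \<sigma>\<^sub>1 \<sigma>\<^sub>2 z x j = 0 \<longleftrightarrow>
    (\<exists>k\<in>cone_idx T\<^sub>1 \<sigma>\<^sub>1. z k = 0 \<and> toric_exponent T\<^sub>1 T\<^sub>2 f \<sigma>\<^sub>2 j k \<noteq> 0)"
  using assms unfolding toric_monomials_def by (simp add: prod_real_pow)

text \<open>The two choices of logarithms are compared only at nonzero coordinates, which is all
  that is known when they come from two points of one orbit.\<close>

lemma toric_monomials_twist:
  assumes fin: "finite (cone_idx T\<^sub>1 \<sigma>\<^sub>1)"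
    and x': "\<And>k. k \<in> cone_idx T\<^sub>1 \<sigma>\<^sub>1 \<Longrightarrow> z k \<noteq> 0 \<Longrightarrow> x' k = x k + c k"
  shows "toric_monomials T\<^sub>1 T\<^sub>2 f \<sigma>\<^sub>1 \<sigma>\<^sub>2 (twist T\<^sub>1 \<sigma>\<^sub>1 c z) x' =
    twist T\<^sub>2 \<sigma>\<^sub>2 (\<lambda>j. \<Sum>k\<in>cone_idx T\<^sub>1 \<sigma>\<^sub>1. of_real (toric_exponent T\<^sub>1 T\<^sub>2 f \<sigma>\<^sub>2 j k) * c k)
      (toric_monomials T\<^sub>1 T\<^sub>2 f \<sigma>\<^sub>1 \<sigma>\<^sub>2 z x)"
proof
  fix j
  let ?I = "cone_idx T\<^sub>1 \<sigma>\<^sub>1" and ?a = "toric_exponent T\<^sub>1 T\<^sub>2 f \<sigma>\<^sub>2 j"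
  have zero: "k \<in> ?I \<Longrightarrow> twist T\<^sub>1 \<sigma>\<^sub>1 c z k = 0 \<longleftrightarrow> z k = 0" for k
    unfolding twist_def by simp
  let ?P = "\<exists>k\<in>?I. z k = 0 \<and> ?a k \<noteq> 0"
  let ?S = "\<lambda>x. \<Sum>k\<in>?I. if z k = 0 then 0 else of_real (?a k) * x k"
  have ex: "(\<exists>k\<in>?I. twist T\<^sub>1 \<sigma>\<^sub>1 c z k = 0 \<and> ?a k \<noteq> 0) = ?P"
    by (intro bex_cong refl) (simp add: zero)
  have sums: "(\<Sum>k\<in>?I. if twist T\<^sub>1 \<sigma>\<^sub>1 c z k = 0 then 0 else of_real (?a k) * x' k) = ?S x'"
    by (intro sum.cong refl) (simp add: zero)
  \<comment> \<open>The sum with \<open>c\<close> runs over all indices, the other two only over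
    nonzero coordinates. They agree because, when no factor vanishes, the exponent at every zero
    coordinate is 0.\<close>
  have "?S x' = (\<Sum>k\<in>?I. of_real (?a k) * c k) + ?S x" if "\<not> ?P"
    unfolding sum.distrib[symmetric] using that x' by (intro sum.cong refl) (auto simp: algebra_simps)
  then have "(\<Prod>k\<in>?I. real_pow (twist T\<^sub>1 \<sigma>\<^sub>1 c z k) (x' k) (?a k)) =
      e2pi (\<Sum>k\<in>?I. of_real (?a k) * c k) * (\<Prod>k\<in>?I. real_pow (z k) (x k) (?a k))"
    unfolding prod_real_pow[OF fin] ex sums by (cases ?P) (simp_all only: if_True if_False e2pi_add mult_zero_right not_False_eq_True)
  then show "toric_monomials T\<^sub>1 T\<^sub>2 f \<sigma>\<^sub>1 \<sigma>\<^sub>2 (twist T\<^sub>1 \<sigma>\<^sub>1 c z) x' j = twist T\<^sub>2 \<sigma>\<^sub>2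
      (\<lambda>j. \<Sum>k\<in>?I. of_real (toric_exponent T\<^sub>1 T\<^sub>2 f \<sigma>\<^sub>2 j k) * c k)
      (toric_monomials T\<^sub>1 T\<^sub>2 f \<sigma>\<^sub>1 \<sigma>\<^sub>2 z x) j"
    unfolding toric_monomials_def twist_def by simp
qed

text \<open>The part of a fan morphism that does not mention cones. It covers \<open>f\<close>, the
  identity and composites alike, and it already makes the affine maps well defined on orbits; cones
  enter only for the codomain and for composition.\<close>

locale quasilattice_map =
  fixes T\<^sub>1 :: "'n::finite fan_triple" and T\<^sub>2 :: "'m::finite fan_triple"
    and f :: "real^'n \<Rightarrow> real^'m"
  assumes T\<^sub>1: "fan_fundamental_triple T\<^sub>1" and T\<^sub>2: "fan_fundamental_triple T\<^sub>2"
    and lin: "linear f" and qlat: "f ` qlat T\<^sub>1 \<subseteq> qlat T\<^sub>2"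
begin

lemma clinear_map_add:
  "clinear_map f (u + (\<chi> k. of_real (q $ k))) = clinear_map f u + (\<chi> j. of_real (f q $ j))"
proof -
  have "linear (\<lambda>x. f x $ j)" for j
    using linear_compose[OF lin, of "\<lambda>v. v $ j"] by (simp add: o_def bounded_linear.linear[OF bounded_linear_vec_nth])
  then show ?thesis unfolding clinear_map_def by (simp add: vec_eq_iff cfunctional_add)
qed

context
  fixes \<sigma>\<^sub>1 \<sigma>\<^sub>2
  assumes \<sigma>\<^sub>1: "\<sigma>\<^sub>1 \<in> max_cones T\<^sub>1" and \<sigma>\<^sub>2: "\<sigma>\<^sub>2 \<in> max_cones T\<^sub>2"
begin

abbreviation (input) "I \<equiv> cone_idx T\<^sub>1 \<sigma>\<^sub>1"
abbreviation (input) "J \<equiv> cone_idx T\<^sub>2 \<sigma>\<^sub>2"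
abbreviation (input) "M \<equiv> toric_monomials T\<^sub>1 T\<^sub>2 f \<sigma>\<^sub>1 \<sigma>\<^sub>2"
abbreviation (input) "a \<equiv> toric_exponent T\<^sub>1 T\<^sub>2 f \<sigma>\<^sub>2"

lemma finite_I: "finite I"
  using cone_idx(1)[OF T\<^sub>1 max_cone_fan[OF T\<^sub>1 \<sigma>\<^sub>1]] .

text \<open>The exponents form the matrix of \<open>f\<close>, so applying row \<open>j\<close> to
  coefficients \<open>r\<close> evaluates the j-th dual functional on the image of the vector with
  those coefficients.\<close>

lemma exponent_comb:
  assumes "j \<in> J"
  shows "(\<Sum>k\<in>I. a j k * r k) = dual_basis T\<^sub>2 \<sigma>\<^sub>2 j (f (\<Sum>k\<in>I. r k *\<^sub>R gen T\<^sub>1 k))"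
  using linear_dual_basis[OF T\<^sub>2 \<sigma>\<^sub>2 assms] lin
  by (simp add: linear_sum linear_cmul toric_exponent_def mult.commute)

lemma exponent_dual:
  assumes "j \<in> J"
  shows "(\<Sum>k\<in>I. a j k * dual_basis T\<^sub>1 \<sigma>\<^sub>1 k v) = dual_basis T\<^sub>2 \<sigma>\<^sub>2 j (f v)"
  unfolding exponent_comb[OF assms] dual_basis_expand[OF T\<^sub>1 \<sigma>\<^sub>1] ..

text \<open>The matrix is real, so real and imaginary parts of \<open>u\<close> can be treated
  separately by \<open>exponent_dual\<close>.\<close>

lemma exponent_dual_complex:
  assumes "j \<in> J"
  shows "(\<Sum>k\<in>I. of_real (a j k) * dual_complex T\<^sub>1 \<sigma>\<^sub>1 u k) = dual_complex T\<^sub>2 \<sigma>\<^sub>2 (clinear_map f u) j"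
proof -
  have "(\<chi> k. Re (clinear_map f u $ k)) = f (\<chi> k. Re (u $ k))"
    and "(\<chi> k. Im (clinear_map f u $ k)) = f (\<chi> k. Im (u $ k))"
    unfolding clinear_map_def cfunctional_def by (simp_all add: vec_eq_iff)
  then show ?thesis
    unfolding dual_complex_def cfunctional_def
    by (simp add: complex_eq_iff exponent_dual[OF assms, symmetric])
qed

text \<open>Logarithms of two points of an orbit differ by the dual coordinates of some
  \<open>q\<close> plus integers, and together these are the dual coordinates of a single lattice
  vector, which \<open>f\<close> sends to the target lattice. No sign condition is involved, since
  \<open>real_pow\<close> has a fixed value at 0 for each exponent.\<close>

lemma orb_toric_monomials:
  assumes z: "z \<in> I \<rightarrow>\<^sub>E UNIV" and x: "x \<in> logs I z"
    and w: "w \<in> orb T\<^sub>1 \<sigma>\<^sub>1 z" and x': "x' \<in> logs I w"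
  shows "orb T\<^sub>2 \<sigma>\<^sub>2 (M w x') = orb T\<^sub>2 \<sigma>\<^sub>2 (M z x)"
proof -
  obtain q where q: "q \<in> qlat T\<^sub>1" "w = twist T\<^sub>1 \<sigma>\<^sub>1 (dual_real T\<^sub>1 \<sigma>\<^sub>1 q) z"
    using w unfolding orb_iff by (elim conjE bexE)
  have "\<exists>n::int. z k \<noteq> 0 \<longrightarrow> x' k = x k + (dual_real T\<^sub>1 \<sigma>\<^sub>1 q k + of_int n)" if k: "k \<in> I" for k
  proof (cases "z k = 0")
    case False
    have wk: "w k = e2pi (dual_real T\<^sub>1 \<sigma>\<^sub>1 q k) * z k" using k unfolding q(2) twist_def by simp
    have "e2pi (x' k) = w k" using x' k False wk unfolding logs_def by simp
    also have "\<dots> = e2pi (x k + dual_real T\<^sub>1 \<sigma>\<^sub>1 q k)"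
      using x k False wk unfolding logs_def by (simp add: e2pi_add)
    finally show ?thesis by (rule e2pi_eqD) (auto simp: algebra_simps)
  qed simp
  then have "\<forall>k\<in>I. \<exists>n::int. z k \<noteq> 0 \<longrightarrow> x' k = x k + (dual_real T\<^sub>1 \<sigma>\<^sub>1 q k + of_int n)" by blast
  from bchoice[OF this] obtain n :: "nat \<Rightarrow> int"
    where n: "\<forall>k\<in>I. z k \<noteq> 0 \<longrightarrow> x' k = x k + (dual_real T\<^sub>1 \<sigma>\<^sub>1 q k + of_int (n k))" ..
  \<comment> \<open>The k-th dual coordinate of \<open>q'\<close> is that of \<open>q\<close> plus
    \<open>n k\<close>; it is a lattice vector because the generators belong to the lattice.\<close>
  define q' where "q' = q + (\<Sum>k\<in>I. of_int (n k) *\<^sub>R gen T\<^sub>1 k)"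
  have "q' \<in> qlat T\<^sub>1"
    unfolding q'_def by (intro qlat_add[OF T\<^sub>1 q(1)] qlat_sum[OF T\<^sub>1 finite_I] gen_in_qlat[OF T\<^sub>1 max_cone_fan[OF T\<^sub>1 \<sigma>\<^sub>1]])
  then have q': "f q' \<in> qlat T\<^sub>2" by (intro subsetD[OF qlat] imageI)
  \<comment> \<open>Integers do not change the exponential, so \<open>w\<close> is the twist by
    \<open>?c\<close> at every coordinate, including the zeros, where \<open>n k\<close> is
    arbitrary.\<close>
  let ?c = "\<lambda>k. dual_real T\<^sub>1 \<sigma>\<^sub>1 q k + of_int (n k)"
  have "w = twist T\<^sub>1 \<sigma>\<^sub>1 ?c z"
    unfolding q(2) twist_def by (intro restrict_ext) (simp only: e2pi_add e2pi_of_int mult_1_right)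
  then have Mw: "M w x' = twist T\<^sub>2 \<sigma>\<^sub>2 (\<lambda>j. \<Sum>k\<in>I. of_real (a j k) * ?c k) (M z x)"
    using toric_monomials_twist[OF finite_I, of z x' x ?c] n by simp
  have tw: "twist T\<^sub>2 \<sigma>\<^sub>2 (\<lambda>j. \<Sum>k\<in>I. of_real (a j k) * ?c k) (M z x) =
      twist T\<^sub>2 \<sigma>\<^sub>2 (dual_real T\<^sub>2 \<sigma>\<^sub>2 (f q')) (M z x)"
  proof (rule twist_cong)
    fix j assume j: "j \<in> J"
    have "(\<Sum>k\<in>I. of_real (a j k) * ?c k) =
        of_real (\<Sum>k\<in>I. a j k * (dual_basis T\<^sub>1 \<sigma>\<^sub>1 k q + of_int (n k)))"
      unfolding dual_real_def by simp
    also have "\<dots> = of_real (dual_basis T\<^sub>2 \<sigma>\<^sub>2 j (f q'))"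
      unfolding exponent_comb[OF j] q'_def
      by (simp add: scaleR_add_left sum.distrib dual_basis_expand[OF T\<^sub>1 \<sigma>\<^sub>1])
    finally show "(\<Sum>k\<in>I. of_real (a j k) * ?c k) = dual_real T\<^sub>2 \<sigma>\<^sub>2 (f q') j"
      unfolding dual_real_def .
  qed
  show ?thesis unfolding Mw tw by (rule orb_twist[OF T\<^sub>2 \<sigma>\<^sub>2 q' toric_monomials_PiE])
qed

lemma affine_toric_map_orb:
  assumes z: "z \<in> I \<rightarrow>\<^sub>E UNIV" and x: "x \<in> logs I z"
  shows "affine_toric_map T\<^sub>1 T\<^sub>2 f \<sigma>\<^sub>1 \<sigma>\<^sub>2 (orb T\<^sub>1 \<sigma>\<^sub>1 z) = orb T\<^sub>2 \<sigma>\<^sub>2 (M z x)"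
  unfolding affine_toric_map_alt
proof (intro subset_antisym subsetI)
  fix p assume "p \<in> (\<Union>w\<in>orb T\<^sub>1 \<sigma>\<^sub>1 z. \<Union>x\<in>logs I w. orb T\<^sub>2 \<sigma>\<^sub>2 (M w x))"
  then obtain w x' where "w \<in> orb T\<^sub>1 \<sigma>\<^sub>1 z" "x' \<in> logs I w" "p \<in> orb T\<^sub>2 \<sigma>\<^sub>2 (M w x')" by (elim UN_E)
  then show "p \<in> orb T\<^sub>2 \<sigma>\<^sub>2 (M z x)" using orb_toric_monomials[OF z x] by simp
next
  fix p assume "p \<in> orb T\<^sub>2 \<sigma>\<^sub>2 (M z x)"
  then show "p \<in> (\<Union>w\<in>orb T\<^sub>1 \<sigma>\<^sub>1 z. \<Union>x\<in>logs I w. orb T\<^sub>2 \<sigma>\<^sub>2 (M w x))"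
    by (intro UN_I[OF orb_self[OF T\<^sub>1 \<sigma>\<^sub>1 z]] UN_I[OF x])
qed

lemma affine_toric_map_piece_act:
  assumes "y \<in> affine_piece T\<^sub>1 \<sigma>\<^sub>1 \<delta>"
  shows "affine_toric_map T\<^sub>1 T\<^sub>2 f \<sigma>\<^sub>1 \<sigma>\<^sub>2 (piece_act T\<^sub>1 \<sigma>\<^sub>1 u y) =
    piece_act T\<^sub>2 \<sigma>\<^sub>2 (clinear_map f u) (affine_toric_map T\<^sub>1 T\<^sub>2 f \<sigma>\<^sub>1 \<sigma>\<^sub>2 y)"
proof -
  obtain z where z: "z \<in> I \<rightarrow>\<^sub>E UNIV" "y = orb T\<^sub>1 \<sigma>\<^sub>1 z"
    using assms by (rule affine_pieceE[OF T\<^sub>1 \<sigma>\<^sub>1])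
  obtain x where x: "x \<in> logs I z" using logs_nonempty by blast
  let ?c = "dual_complex T\<^sub>1 \<sigma>\<^sub>1 u"
  have x': "(\<lambda>k. x k + ?c k) \<in> logs I (twist T\<^sub>1 \<sigma>\<^sub>1 ?c z)"
    using x unfolding logs_def twist_def by (simp add: e2pi_add)
  have "M (twist T\<^sub>1 \<sigma>\<^sub>1 ?c z) (\<lambda>k. x k + ?c k) =
      twist T\<^sub>2 \<sigma>\<^sub>2 (\<lambda>j. \<Sum>k\<in>I. of_real (a j k) * ?c k) (M z x)"
    by (rule toric_monomials_twist[OF finite_I]) simp
  also have "\<dots> = twist T\<^sub>2 \<sigma>\<^sub>2 (dual_complex T\<^sub>2 \<sigma>\<^sub>2 (clinear_map f u)) (M z x)"
    by (rule twist_cong) (rule exponent_dual_complex)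
  finally show ?thesis
    unfolding z(2) piece_act_orb[OF T\<^sub>1 \<sigma>\<^sub>1 z(1)] affine_toric_map_orb[OF z(1) x]
      affine_toric_map_orb[OF twist_PiE x'] piece_act_orb[OF T\<^sub>2 \<sigma>\<^sub>2 toric_monomials_PiE]
    by (rule arg_cong)
qed

text \<open>On the chart of \<open>\<delta>\<^sub>1\<close> only coordinates with index in
  \<open>cone_idx T\<^sub>1 \<delta>\<^sub>1\<close> can vanish, and their generators are mapped
  into \<open>\<delta>\<^sub>2\<close>. So negative exponents never meet a zero coordinate.\<close>

lemma exponent_face:
  assumes "\<delta>\<^sub>1 \<in> fan T\<^sub>1" "\<delta>\<^sub>2 \<in> fan T\<^sub>2" "\<delta>\<^sub>2 \<subseteq> \<sigma>\<^sub>2" "f ` \<delta>\<^sub>1 \<subseteq> \<delta>\<^sub>2"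
    and "k \<in> cone_idx T\<^sub>1 \<delta>\<^sub>1" "j \<in> J"
  shows "0 \<le> a j k" and "j \<notin> cone_idx T\<^sub>2 \<delta>\<^sub>2 \<Longrightarrow> a j k = 0"
proof -
  have "f (gen T\<^sub>1 k) \<in> \<delta>\<^sub>2"
    using assms(4,5) by (auto simp: cone_idx_eq[OF T\<^sub>1 assms(1)])
  then show "0 \<le> a j k" and "j \<notin> cone_idx T\<^sub>2 \<delta>\<^sub>2 \<Longrightarrow> a j k = 0"
    unfolding toric_exponent_def using dual_basis_face[OF T\<^sub>2 \<sigma>\<^sub>2 assms(2,3) _ assms(6)] by blast+
qed

text \<open>A target coordinate outside \<open>\<delta>\<^sub>2\<close> has exponent 0 at every
  source coordinate that may vanish, so no zero can enter it.\<close>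

lemma toric_monomials_affine_open:
  assumes "\<delta>\<^sub>1 \<in> fan T\<^sub>1" "\<delta>\<^sub>2 \<in> fan T\<^sub>2" "\<delta>\<^sub>2 \<subseteq> \<sigma>\<^sub>2" "f ` \<delta>\<^sub>1 \<subseteq> \<delta>\<^sub>2"
    and "z \<in> affine_open T\<^sub>1 \<sigma>\<^sub>1 \<delta>\<^sub>1"
  shows "M z x \<in> affine_open T\<^sub>2 \<sigma>\<^sub>2 \<delta>\<^sub>2"
  using assms(5) exponent_face(2)[OF assms(1-4)] toric_monomials_PiE[of T\<^sub>1 T\<^sub>2 f \<sigma>\<^sub>1 \<sigma>\<^sub>2 z x]
  unfolding affine_open_def by (auto simp: toric_monomials_eq_0_iff[OF finite_I])

lemma affine_toric_map_piece:
  assumes "\<delta>\<^sub>1 \<in> fan T\<^sub>1" "\<delta>\<^sub>2 \<in> fan T\<^sub>2" "\<delta>\<^sub>2 \<subseteq> \<sigma>\<^sub>2" "f ` \<delta>\<^sub>1 \<subseteq> \<delta>\<^sub>2"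
    and "y \<in> affine_piece T\<^sub>1 \<sigma>\<^sub>1 \<delta>\<^sub>1"
  shows "affine_toric_map T\<^sub>1 T\<^sub>2 f \<sigma>\<^sub>1 \<sigma>\<^sub>2 y \<in> affine_piece T\<^sub>2 \<sigma>\<^sub>2 \<delta>\<^sub>2"
proof -
  obtain z where z: "z \<in> affine_open T\<^sub>1 \<sigma>\<^sub>1 \<delta>\<^sub>1" "z \<in> I \<rightarrow>\<^sub>E UNIV" "y = orb T\<^sub>1 \<sigma>\<^sub>1 z"
    using assms(5) by (rule affine_pieceE[OF T\<^sub>1 \<sigma>\<^sub>1])
  obtain x where x: "x \<in> logs I z" using logs_nonempty by blast
  show ?thesis
    unfolding z(3) affine_toric_map_orb[OF z(2) x] affine_piece_iff
    by (rule bexI[rotated], rule toric_monomials_affine_open[OF assms(1-4) z(1)]) (rule refl)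
qed

end

end

section \<open>Composition and gluing\<close>

text \<open>Nonnegativity of the exponents at vanishing coordinates prevents the exponents
  \<open>\<Sum>j. b j * a j k\<close> from cancelling, so that both sides vanish simultaneously.\<close>
lemma prod_real_pow_comp:
  fixes a :: "nat \<Rightarrow> nat \<Rightarrow> real"
  assumes fin: "finite I" "finite J"
    and a: "\<And>j k. j \<in> J \<Longrightarrow> k \<in> I \<Longrightarrow> z k = 0 \<Longrightarrow> 0 \<le> a j k"
    and b: "\<And>j. j \<in> J \<Longrightarrow> w j = 0 \<Longrightarrow> 0 \<le> b j"
    and w: "\<And>j. j \<in> J \<Longrightarrow> w j = 0 \<longleftrightarrow> (\<exists>k\<in>I. z k = 0 \<and> a j k \<noteq> 0)"
  shows "(\<Prod>j\<in>J. real_pow (w j) (\<Sum>k\<in>I. if z k = 0 then 0 else of_real (a j k) * x k) (b j)) =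
    (\<Prod>k\<in>I. real_pow (z k) (x k) (\<Sum>j\<in>J. b j * a j k))"
proof -
  let ?P = "\<exists>j\<in>J. w j = 0 \<and> b j \<noteq> 0"
  let ?c = "\<lambda>k. \<Sum>j\<in>J. b j * a j k"
  have "?P \<longleftrightarrow> (\<exists>k\<in>I. z k = 0 \<and> ?c k \<noteq> 0)"
  proof
    assume ?P
    then obtain j where j: "j \<in> J" "w j = 0" "b j \<noteq> 0" by blast
    then obtain k where k: "k \<in> I" "z k = 0" "a j k \<noteq> 0" using w by blast
    have "0 < ?c k"
    proof (rule sum_pos2[OF fin(2) j(1)])
      show "0 < b j * a j k"
        using a[OF j(1) k(1,2)] b[OF j(1,2)] j(3) k(3) by simp
      fix j' assume j': "j' \<in> J"
      show "0 \<le> b j' * a j' k"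
      proof (cases "a j' k = 0")
        \<comment> \<open>A nonzero exponent at the zero coordinate \<open>k\<close> makes
          \<open>w j'\<close> vanish, and only for vanishing \<open>w j'\<close> is the sign of
          \<open>b j'\<close> known.\<close>
        case False
        then have "w j' = 0" using w[OF j'] k by blast
        then show ?thesis using a[OF j' k(1,2)] b[OF j'] by simp
      qed simp
    qed
    then show "\<exists>k\<in>I. z k = 0 \<and> ?c k \<noteq> 0" using k by force
  next
    assume "\<exists>k\<in>I. z k = 0 \<and> ?c k \<noteq> 0"
    then obtain k where k: "k \<in> I" "z k = 0" "?c k \<noteq> 0" by blast
    then obtain j where "j \<in> J" "b j * a j k \<noteq> 0" by (meson sum.neutral)
    then show ?P using w k by auto
  qed
  moreover have "(\<Sum>j\<in>J. if w j = 0 then 0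
        else of_real (b j) * (\<Sum>k\<in>I. if z k = 0 then 0 else of_real (a j k) * x k)) =
      (\<Sum>k\<in>I. if z k = 0 then 0 else of_real (?c k) * x k)" if "\<not> ?P"
  proof -
    have "(\<Sum>j\<in>J. if w j = 0 then 0
        else of_real (b j) * (\<Sum>k\<in>I. if z k = 0 then 0 else of_real (a j k) * x k)) =
      (\<Sum>j\<in>J. \<Sum>k\<in>I. if z k = 0 then 0 else of_real (b j * a j k) * x k)"
    proof (intro sum.cong refl)
      fix j assume "j \<in> J"
      then have "w j = 0 \<Longrightarrow> b j = 0" using that by blast
      then show "(if w j = 0 then 0
          else of_real (b j) * (\<Sum>k\<in>I. if z k = 0 then 0 else of_real (a j k) * x k)) =
        (\<Sum>k\<in>I. if z k = 0 then 0 else of_real (b j * a j k) * x k)"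
        by (cases "w j = 0") (simp cong: if_cong, auto simp: sum_distrib_left mult.assoc intro!: sum.cong)
    qed
    also have "\<dots> = (\<Sum>k\<in>I. \<Sum>j\<in>J. if z k = 0 then 0 else of_real (b j * a j k) * x k)"
      by (rule sum.swap)
    also have "\<dots> = (\<Sum>k\<in>I. if z k = 0 then 0 else of_real (?c k) * x k)"
      by (intro sum.cong refl) (simp add: sum_distrib_right)
    finally show ?thesis .
  qed
  ultimately show ?thesis
    unfolding prod_real_pow[OF fin(1)] prod_real_pow[OF fin(2)]
    by (cases ?P) (simp_all only: if_True if_False not_False_eq_True)
qed

text \<open>With compatible logarithms the composite monomials agree exactly, not merely up to an
  orbit. The three cones serve to control signs at vanishing coordinates, so they may be much
  smaller than the maximal cones.\<close>

lemma affine_toric_map_comp: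
  assumes f: "quasilattice_map T\<^sub>1 T\<^sub>2 f" and g: "quasilattice_map T\<^sub>2 T\<^sub>3 g"
    and \<sigma>: "\<sigma>\<^sub>1 \<in> max_cones T\<^sub>1" "\<sigma>\<^sub>2 \<in> max_cones T\<^sub>2" "\<sigma>\<^sub>3 \<in> max_cones T\<^sub>3"
    and \<delta>\<^sub>1: "\<delta>\<^sub>1 \<in> fan T\<^sub>1" and \<delta>\<^sub>2: "\<delta>\<^sub>2 \<in> fan T\<^sub>2" "\<delta>\<^sub>2 \<subseteq> \<sigma>\<^sub>2"
    and \<delta>\<^sub>3: "\<delta>\<^sub>3 \<in> fan T\<^sub>3" "\<delta>\<^sub>3 \<subseteq> \<sigma>\<^sub>3"
    and sub: "f ` \<delta>\<^sub>1 \<subseteq> \<delta>\<^sub>2" "g ` \<delta>\<^sub>2 \<subseteq> \<delta>\<^sub>3" and y: "y \<in> affine_piece T\<^sub>1 \<sigma>\<^sub>1 \<delta>\<^sub>1"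
  shows "affine_toric_map T\<^sub>2 T\<^sub>3 g \<sigma>\<^sub>2 \<sigma>\<^sub>3 (affine_toric_map T\<^sub>1 T\<^sub>2 f \<sigma>\<^sub>1 \<sigma>\<^sub>2 y) =
    affine_toric_map T\<^sub>1 T\<^sub>3 (g \<circ> f) \<sigma>\<^sub>1 \<sigma>\<^sub>3 y"
proof -
  interpret f: quasilattice_map T\<^sub>1 T\<^sub>2 f by (rule f)
  interpret g: quasilattice_map T\<^sub>2 T\<^sub>3 g by (rule g)
  have "(g \<circ> f) ` qlat T\<^sub>1 \<subseteq> qlat T\<^sub>3" using f.qlat g.qlat by fastforce
  then interpret gf: quasilattice_map T\<^sub>1 T\<^sub>3 "g \<circ> f"
    by (intro quasilattice_map.intro f.T\<^sub>1 g.T\<^sub>2 linear_compose f.lin g.lin)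
  let ?I = "cone_idx T\<^sub>1 \<sigma>\<^sub>1" and ?J = "cone_idx T\<^sub>2 \<sigma>\<^sub>2"
  let ?a = "toric_exponent T\<^sub>1 T\<^sub>2 f \<sigma>\<^sub>2" and ?b = "toric_exponent T\<^sub>2 T\<^sub>3 g \<sigma>\<^sub>3"
  note finI = f.finite_I[OF \<sigma>(1,2)] and finJ = g.finite_I[OF \<sigma>(2,3)]
  obtain z where z: "z \<in> affine_open T\<^sub>1 \<sigma>\<^sub>1 \<delta>\<^sub>1" "z \<in> ?I \<rightarrow>\<^sub>E UNIV" "y = orb T\<^sub>1 \<sigma>\<^sub>1 z"
    using y by (rule affine_pieceE[OF f.T\<^sub>1 \<sigma>(1)])
  obtain x where x: "x \<in> logs ?I z" using logs_nonempty by blast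
  define w where "w = toric_monomials T\<^sub>1 T\<^sub>2 f \<sigma>\<^sub>1 \<sigma>\<^sub>2 z x"
  \<comment> \<open>The linear form that appears in the exponential of the first monomials is itself
    a logarithm of each nonzero \<open>w j\<close>; choosing it turns the composition into a matrix
    product.\<close>
  define x' where "x' j = (\<Sum>k\<in>?I. if z k = 0 then 0 else of_real (?a j k) * x k)" for j
  have w0: "w j = 0 \<longleftrightarrow> (\<exists>k\<in>?I. z k = 0 \<and> ?a j k \<noteq> 0)" if "j \<in> ?J" for j
    unfolding w_def using toric_monomials_eq_0_iff[where f = f, OF finI that] .
  have wU: "w \<in> affine_open T\<^sub>2 \<sigma>\<^sub>2 \<delta>\<^sub>2"
    unfolding w_def by (rule f.toric_monomials_affine_open[OF \<sigma>(1,2) \<delta>\<^sub>1 \<delta>\<^sub>2 sub(1) z(1)])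
  have x': "x' \<in> logs ?J w"
    unfolding logs_def x'_def using w0
    by (auto simp: w_def toric_monomials_def prod_real_pow[OF finI] split: if_splits)
  have a: "0 \<le> ?a j k" if "j \<in> ?J" "k \<in> ?I" "z k = 0" for j k
    using f.exponent_face(1)[OF \<sigma>(1,2) \<delta>\<^sub>1 \<delta>\<^sub>2 sub(1)] z(1) that unfolding affine_open_def by blast
  have b: "0 \<le> ?b i j" if "i \<in> cone_idx T\<^sub>3 \<sigma>\<^sub>3" "j \<in> ?J" "w j = 0" for i j
    using g.exponent_face(1)[OF \<sigma>(2,3) \<delta>\<^sub>2(1) \<delta>\<^sub>3 sub(2)] wU that unfolding affine_open_def by blast
  \<comment> \<open>Matrix multiplication: \<open>f (gen T\<^sub>1 k)\<close> is expanded in the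
    generators of \<open>\<sigma>\<^sub>2\<close>.\<close>
  have exps: "(\<Sum>j\<in>?J. ?b i j * ?a j k) = toric_exponent T\<^sub>1 T\<^sub>3 (g \<circ> f) \<sigma>\<^sub>3 i k"
    if "i \<in> cone_idx T\<^sub>3 \<sigma>\<^sub>3" for i k
    using g.exponent_dual[OF \<sigma>(2,3) that, of "f (gen T\<^sub>1 k)"] by (simp add: toric_exponent_def)
  have "toric_monomials T\<^sub>2 T\<^sub>3 g \<sigma>\<^sub>2 \<sigma>\<^sub>3 w x' = toric_monomials T\<^sub>1 T\<^sub>3 (g \<circ> f) \<sigma>\<^sub>1 \<sigma>\<^sub>3 z x"
    unfolding toric_monomials_def
  proof (rule restrict_ext)
    fix i assume i: "i \<in> cone_idx T\<^sub>3 \<sigma>\<^sub>3"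
    show "(\<Prod>j\<in>?J. real_pow (w j) (x' j) (?b i j)) =
      (\<Prod>k\<in>?I. real_pow (z k) (x k) (toric_exponent T\<^sub>1 T\<^sub>3 (g \<circ> f) \<sigma>\<^sub>3 i k))"
      unfolding exps[OF i, symmetric] x'_def
      by (rule prod_real_pow_comp[OF finI finJ a b[OF i] w0])
  qed
  then show ?thesis
    unfolding z(3) f.affine_toric_map_orb[OF \<sigma>(1,2) z(2) x]
      gf.affine_toric_map_orb[OF \<sigma>(1,3) z(2) x] w_def[symmetric]
      g.affine_toric_map_orb[OF \<sigma>(2,3) affine_open_PiE[OF wU] x']
    by (rule arg_cong)
qed

section \<open>Gluing as an equivalence relation\<close>

lemma piece_points_iff:
  "(\<sigma>, \<delta>, y) \<in> piece_points T \<longleftrightarrow> \<sigma> \<in> max_cones T \<and> cone_face \<delta> \<sigma> \<and> y \<in> affine_piece T \<sigma> \<delta>"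
  unfolding piece_points_def by simp

lemma clinear_map_id: "clinear_map id u = u"
  unfolding clinear_map_def cfunctional_def by (simp add: vec_eq_iff complex_eq_iff)

lemma torus_rel_iff: "w \<in> torus_rel T `` {u} \<longleftrightarrow> (\<exists>q\<in>qlat T. w = u + (\<chi> k. of_real (q $ k)))"
  unfolding torus_rel_def by simp

context
  fixes T :: "'n::finite fan_triple"
  assumes T: "fan_fundamental_triple T"
begin

lemma quasilattice_map_id: "quasilattice_map T T id"
  by (intro quasilattice_map.intro T linear_id) simp

interpretation qid: quasilattice_map T T id by (rule quasilattice_map_id)

text \<open>The exponents are Kronecker deltas. A factor with exponent 0 is 1 even at a zero
  coordinate, so only the factor with \<open>k = j\<close> survives.\<close>

lemma affine_toric_map_id:
  assumes \<sigma>: "\<sigma> \<in> max_cones T" and y: "y \<in> affine_piece T \<sigma> \<delta>"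
  shows "affine_toric_map T T id \<sigma> \<sigma> y = y"
proof -
  let ?I = "cone_idx T \<sigma>"
  obtain z where z: "z \<in> ?I \<rightarrow>\<^sub>E UNIV" "y = orb T \<sigma> z"
    using y by (rule affine_pieceE[OF T \<sigma>])
  obtain x where x: "x \<in> logs ?I z" using logs_nonempty by blast
  have "toric_monomials T T id \<sigma> \<sigma> z x = z"
  proof
    fix j
    show "toric_monomials T T id \<sigma> \<sigma> z x j = z j"
    proof (cases "j \<in> ?I")
      case True
      have "(\<Prod>k\<in>?I. real_pow (z k) (x k) (toric_exponent T T id \<sigma> j k)) =
          (\<Prod>k\<in>?I. if k = j then z k else 1)"
        using x dual_basis_gen[OF T \<sigma> True]
        by (intro prod.cong refl) (auto simp: real_pow_def logs_def toric_exponent_def)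
      then show ?thesis
        using True qid.finite_I[OF \<sigma> \<sigma>] by (simp add: toric_monomials_def)
    next
      case False
      then show ?thesis using z(1) by (auto simp: toric_monomials_def)
    qed
  qed
  then show ?thesis unfolding z(2) qid.affine_toric_map_orb[OF \<sigma> \<sigma> z(1) x] by (rule arg_cong)
qed

lemma affine_piece_mono:
  assumes "\<sigma> \<in> max_cones T" "\<delta> \<in> fan T" "\<gamma> \<in> fan T" "\<delta> \<subseteq> \<gamma>"
  shows "affine_piece T \<sigma> \<delta> \<subseteq> affine_piece T \<sigma> \<gamma>"
  using affine_piece_Int[OF T assms(1-3)] assms(4) by (metis inf.absorb1 inf.cobounded2)

text \<open>The identity composed with itself is the identity; the common cone \<delta> excludes
  negative exponents at zero coordinates.\<close>

lemma gluing_comp: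
  assumes "\<sigma> \<in> max_cones T" "\<tau> \<in> max_cones T" "\<upsilon> \<in> max_cones T"
    and "\<delta> \<in> fan T" "\<delta> \<subseteq> \<tau>" "\<delta> \<subseteq> \<upsilon>" "y \<in> affine_piece T \<sigma> \<delta>"
  shows "affine_toric_map T T id \<tau> \<upsilon> (affine_toric_map T T id \<sigma> \<tau> y) = affine_toric_map T T id \<sigma> \<upsilon> y"
  using affine_toric_map_comp[OF quasilattice_map_id quasilattice_map_id assms(1-3,4,4,5,4,6) _ _ assms(7)]
  by simp

lemma gluing_piece:
  assumes "\<sigma> \<in> max_cones T" "\<tau> \<in> max_cones T" "\<delta> \<in> fan T" "\<delta> \<subseteq> \<tau>" "y \<in> affine_piece T \<sigma> \<delta>"
  shows "affine_toric_map T T id \<sigma> \<tau> y \<in> affine_piece T \<tau> \<delta>"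
  using qid.affine_toric_map_piece[OF assms(1,2,3,3,4) _ assms(5)] by simp

lemma max_cone_face:
  assumes "\<sigma> \<in> max_cones T" "cone_face \<delta> \<sigma>" shows "\<delta> \<in> fan T" "\<delta> \<subseteq> \<sigma>"
  using fan_faceD[OF T max_cone_fan[OF T assms(1)] assms(2)] cone_face_subset[OF assms(2)] .

text \<open>A cone \<kappa> inside the overlap is enough, because pieces grow with the cone and the
  gluing map sends overlap to overlap. Transitivity supplies only such a smaller cone.\<close>

lemma glue_relI:
  assumes "(\<sigma>, \<delta>, y) \<in> piece_points T" "(\<tau>, \<gamma>, y') \<in> piece_points T"
    and "\<kappa> \<in> fan T" "\<kappa> \<subseteq> \<delta> \<inter> \<gamma>"
    and "y \<in> affine_piece T \<sigma> \<kappa>" "y' = affine_toric_map T T id \<sigma> \<tau> y"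
  shows "((\<sigma>, \<delta>, y), (\<tau>, \<gamma>, y')) \<in> glue_rel T"
proof -
  have \<sigma>: "\<sigma> \<in> max_cones T" "cone_face \<delta> \<sigma>" and \<tau>: "\<tau> \<in> max_cones T" "cone_face \<gamma> \<tau>"
    using assms(1,2) unfolding piece_points_iff by blast+
  note \<delta> = max_cone_face[OF \<sigma>] and \<gamma> = max_cone_face[OF \<tau>]
  have "y \<in> affine_piece T \<sigma> (\<delta> \<inter> \<gamma>)"
    using affine_piece_mono[OF \<sigma>(1) assms(3) fan_Int(3)[OF T \<delta>(1) \<gamma>(1)] assms(4)] assms(5) by (rule subsetD)
  moreover from this have "affine_toric_map T T id \<sigma> \<tau> y \<in> affine_piece T \<tau> (\<delta> \<inter> \<gamma>)"
    using \<gamma>(2) by (intro gluing_piece[OF \<sigma>(1) \<tau>(1) fan_Int(3)[OF T \<delta>(1) \<gamma>(1)]]) auto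
  ultimately show ?thesis
    using assms(1,2,6) unfolding glue_rel_def by simp
qed

lemma glue_relE:
  assumes "((\<sigma>, \<delta>, y), (\<tau>, \<gamma>, y')) \<in> glue_rel T"
  obtains "\<sigma> \<in> max_cones T" "\<tau> \<in> max_cones T" "(\<sigma>, \<delta>, y) \<in> piece_points T" "(\<tau>, \<gamma>, y') \<in> piece_points T"
    "\<delta> \<in> fan T" "\<delta> \<subseteq> \<sigma>" "\<gamma> \<in> fan T" "\<gamma> \<subseteq> \<tau>"
    "\<delta> \<inter> \<gamma> \<in> fan T" "y \<in> affine_piece T \<sigma> (\<delta> \<inter> \<gamma>)" "y' \<in> affine_piece T \<tau> (\<delta> \<inter> \<gamma>)"
    "y' = affine_toric_map T T id \<sigma> \<tau> y"
proof -
  have "(\<sigma>, \<delta>, y) \<in> piece_points T \<and> (\<tau>, \<gamma>, y') \<in> piece_points T \<and>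
    y \<in> affine_piece T \<sigma> (\<delta> \<inter> \<gamma>) \<and> y' \<in> affine_piece T \<tau> (\<delta> \<inter> \<gamma>) \<and>
    y' = affine_toric_map T T id \<sigma> \<tau> y"
    using assms unfolding glue_rel_def mem_Collect_eq case_prod_conv .
  note * = this[THEN conjunct1] this[THEN conjunct2, THEN conjunct1]
    this[THEN conjunct2, THEN conjunct2, THEN conjunct1]
    this[THEN conjunct2, THEN conjunct2, THEN conjunct2, THEN conjunct1]
    this[THEN conjunct2, THEN conjunct2, THEN conjunct2, THEN conjunct2]
  have \<sigma>: "\<sigma> \<in> max_cones T" "cone_face \<delta> \<sigma>" and \<tau>: "\<tau> \<in> max_cones T" "cone_face \<gamma> \<tau>"
    using *(1,2) unfolding piece_points_iff by blast+
  note \<delta> = max_cone_face[OF \<sigma>] and \<gamma> = max_cone_face[OF \<tau>]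
  show thesis
    by (rule that[OF \<sigma>(1) \<tau>(1) *(1,2) \<delta> \<gamma> fan_Int(3)[OF T \<delta>(1) \<gamma>(1)] *(3-5)])
qed

lemma glue_rel_sym:
  assumes "((\<sigma>, \<delta>, y), (\<tau>, \<gamma>, y')) \<in> glue_rel T" shows "((\<tau>, \<gamma>, y'), (\<sigma>, \<delta>, y)) \<in> glue_rel T"
proof (rule glue_relE[OF assms])
  assume \<sigma>: "\<sigma> \<in> max_cones T" "\<tau> \<in> max_cones T"
    and pp: "(\<sigma>, \<delta>, y) \<in> piece_points T" "(\<tau>, \<gamma>, y') \<in> piece_points T"
    and sub: "\<delta> \<subseteq> \<sigma>" "\<gamma> \<subseteq> \<tau>" and \<kappa>: "\<delta> \<inter> \<gamma> \<in> fan T"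
    and y: "y \<in> affine_piece T \<sigma> (\<delta> \<inter> \<gamma>)" "y' \<in> affine_piece T \<tau> (\<delta> \<inter> \<gamma>)"
    and y': "y' = affine_toric_map T T id \<sigma> \<tau> y"
  have "affine_toric_map T T id \<tau> \<sigma> y' = affine_toric_map T T id \<sigma> \<sigma> y"
    unfolding y' using sub by (intro gluing_comp[OF \<sigma> \<sigma>(1) \<kappa> _ _ y(1)]) auto
  also have "\<dots> = y" by (rule affine_toric_map_id[OF \<sigma>(1) y(1)])
  finally show ?thesis
    by (intro glue_relI[OF pp(2,1) \<kappa> _ y(2)]) auto
qed

text \<open>The middle point lies in two overlap pieces, hence in the piece of the triple
  intersection. Gluing it back shows that \<open>y\<close> lies in the corresponding piece of
  \<sigma>, where the two gluing maps can be composed.\<close>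

lemma glue_rel_trans:
  assumes "((\<sigma>, \<delta>, y), (\<tau>, \<gamma>, y')) \<in> glue_rel T" "((\<tau>, \<gamma>, y'), (\<upsilon>, \<epsilon>, y'')) \<in> glue_rel T"
  shows "((\<sigma>, \<delta>, y), (\<upsilon>, \<epsilon>, y'')) \<in> glue_rel T"
proof (rule glue_relE[OF assms(1)], rule glue_relE[OF assms(2)])
  assume \<sigma>: "\<sigma> \<in> max_cones T" "\<tau> \<in> max_cones T" "\<upsilon> \<in> max_cones T"
    and pp: "(\<sigma>, \<delta>, y) \<in> piece_points T" "(\<upsilon>, \<epsilon>, y'') \<in> piece_points T"
    and sub: "\<delta> \<subseteq> \<sigma>" "\<gamma> \<subseteq> \<tau>" "\<epsilon> \<subseteq> \<upsilon>" and \<kappa>: "\<delta> \<inter> \<gamma> \<in> fan T" "\<gamma> \<inter> \<epsilon> \<in> fan T"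
    and y: "y' \<in> affine_piece T \<tau> (\<delta> \<inter> \<gamma>)" "y' \<in> affine_piece T \<tau> (\<gamma> \<inter> \<epsilon>)"
    and y'': "y'' = affine_toric_map T T id \<tau> \<upsilon> y'" and y': "y' = affine_toric_map T T id \<sigma> \<tau> y"
  let ?\<kappa> = "(\<delta> \<inter> \<gamma>) \<inter> (\<gamma> \<inter> \<epsilon>)"
  have \<kappa>': "?\<kappa> \<in> fan T" by (rule fan_Int(3)[OF T \<kappa>])
  have "y' \<in> affine_piece T \<tau> ?\<kappa>" unfolding affine_piece_Int[OF T \<sigma>(2) \<kappa>] using y by simp
  then have "affine_toric_map T T id \<tau> \<sigma> y' \<in> affine_piece T \<sigma> ?\<kappa>"
    using sub by (intro gluing_piece[OF \<sigma>(2,1) \<kappa>']) auto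
  moreover have "y = affine_toric_map T T id \<tau> \<sigma> y'"
    using glue_rel_sym[OF assms(1)] by (rule glue_relE)
  ultimately have yk: "y \<in> affine_piece T \<sigma> ?\<kappa>" by simp
  have "y'' = affine_toric_map T T id \<sigma> \<upsilon> y"
    unfolding y'' y' using sub by (intro gluing_comp[OF \<sigma> \<kappa>' _ _ yk]) auto
  then show ?thesis by (intro glue_relI[OF pp \<kappa>' _ yk]) auto
qed

lemma equiv_glue_rel: "equiv (piece_points T) (glue_rel T)"
proof (rule equivI)
  show "glue_rel T \<subseteq> piece_points T \<times> piece_points T"
    unfolding glue_rel_def by auto
  show "refl_on (piece_points T) (glue_rel T)"
  proof (rule refl_onI)
    fix P assume "P \<in> piece_points T"
    moreover obtain \<sigma> \<delta> y where P: "P = (\<sigma>, \<delta>, y)" by (cases P)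
    ultimately have pp: "(\<sigma>, \<delta>, y) \<in> piece_points T" by simp
    then have *: "\<sigma> \<in> max_cones T" "cone_face \<delta> \<sigma>" "y \<in> affine_piece T \<sigma> \<delta>"
      unfolding piece_points_iff by blast+
    show "(P, P) \<in> glue_rel T"
      unfolding P using affine_toric_map_id[OF *(1,3)]
      by (intro glue_relI[OF pp pp max_cone_face(1)[OF *(1,2)] _ *(3)]) auto
  qed
  show "sym (glue_rel T)" by (rule symI) (metis glue_rel_sym prod_cases3)
  show "trans (glue_rel T)" by (rule transI) (metis glue_rel_trans prod_cases3)
qed

section \<open>The quasitorus action on glued classes\<close>

lemma piece_points_act:
  "(\<sigma>, \<delta>, y) \<in> piece_points T \<Longrightarrow> (\<sigma>, \<delta>, piece_act T \<sigma> u y) \<in> piece_points T"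
  unfolding piece_points_iff using piece_act_affine_piece[OF T] by blast

text \<open>Gluing maps are affine morphisms of the identity, so equivariance carries the same
  \<open>u\<close> to the other chart; the overlap piece is stable under the action.\<close>

lemma glue_rel_act:
  assumes "((\<sigma>, \<delta>, y), (\<tau>, \<gamma>, y')) \<in> glue_rel T"
  shows "((\<sigma>, \<delta>, piece_act T \<sigma> u y), (\<tau>, \<gamma>, piece_act T \<tau> u y')) \<in> glue_rel T"
proof (rule glue_relE[OF assms])
  assume \<sigma>: "\<sigma> \<in> max_cones T" "\<tau> \<in> max_cones T"
    and pp: "(\<sigma>, \<delta>, y) \<in> piece_points T" "(\<tau>, \<gamma>, y') \<in> piece_points T"
    and \<kappa>: "\<delta> \<inter> \<gamma> \<in> fan T" and y: "y \<in> affine_piece T \<sigma> (\<delta> \<inter> \<gamma>)"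
    and y': "y' = affine_toric_map T T id \<sigma> \<tau> y"
  have "piece_act T \<tau> u y' = affine_toric_map T T id \<sigma> \<tau> (piece_act T \<sigma> u y)"
    unfolding y' qid.affine_toric_map_piece_act[OF \<sigma> y] clinear_map_id ..
  then show ?thesis
    by (intro glue_relI[OF pp(1,2)[THEN piece_points_act] \<kappa> order_refl] piece_act_affine_piece[OF T \<sigma>(1) y])
qed

lemma torus_rel_self: "u \<in> torus_rel T `` {u}"
proof -
  have "u = u + (\<chi> k. of_real ((0::real^'n) $ k))" by (simp add: vec_eq_iff)
  then show ?thesis unfolding torus_rel_def using qlat_0[OF T] by blast
qed

lemma torus_rel_shift:
  assumes "q \<in> qlat T"
  shows "torus_rel T `` {u + (\<chi> k. of_real (q $ k))} = torus_rel T `` {u}"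
proof (intro subset_antisym subsetI)
  fix w assume "w \<in> torus_rel T `` {u + (\<chi> k. of_real (q $ k))}"
  then obtain r where r: "r \<in> qlat T" "w = u + (\<chi> k. of_real (q $ k)) + (\<chi> k. of_real (r $ k))"
    unfolding torus_rel_def by auto
  then have "w = u + (\<chi> k. of_real ((q + r) $ k))" by (simp add: vec_eq_iff)
  then show "w \<in> torus_rel T `` {u}"
    unfolding torus_rel_iff using qlat_add[OF T assms r(1)] by (rule bexI)
next
  fix w assume "w \<in> torus_rel T `` {u}"
  then obtain r where r: "r \<in> qlat T" "w = u + (\<chi> k. of_real (r $ k))"
    unfolding torus_rel_def by auto
  then have "w = u + (\<chi> k. of_real (q $ k)) + (\<chi> k. of_real ((- q + r) $ k))"
    by (simp add: vec_eq_iff)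
  then show "w \<in> torus_rel T `` {u + (\<chi> k. of_real (q $ k))}"
    unfolding torus_rel_iff using qlat_add[OF T qlat_uminus[OF T assms] r(1)] by (rule bexI)
qed

text \<open>The union in the definition of the action is a single class: another \<open>u\<close> in
  the coset acts equally on orbits, and another representative of the point stays glued by
  \<open>glue_rel_act\<close>.\<close>

lemma quasitorus_act_class:
  assumes P: "(\<sigma>, \<delta>, y) \<in> piece_points T"
  shows "quasitorus_act T (torus_rel T `` {u}) (glue_rel T `` {(\<sigma>, \<delta>, y)}) =
    glue_rel T `` {(\<sigma>, \<delta>, piece_act T \<sigma> u y)}"
proof -
  have cls: "glue_rel T `` {(\<tau>, \<gamma>, piece_act T \<tau> w y')} = glue_rel T `` {(\<sigma>, \<delta>, piece_act T \<sigma> u y)}"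
    if w: "w \<in> torus_rel T `` {u}" and P': "((\<sigma>, \<delta>, y), (\<tau>, \<gamma>, y')) \<in> glue_rel T" for w \<tau> \<gamma> y'
  proof -
    obtain q where q: "q \<in> qlat T" "w = u + (\<chi> k. of_real (q $ k))"
      using w unfolding torus_rel_def by auto
    have "(\<tau>, \<gamma>, y') \<in> piece_points T" using P' by (rule glue_relE)
    then have "\<tau> \<in> max_cones T" "y' \<in> affine_piece T \<tau> \<gamma>" unfolding piece_points_iff by blast+
    then have "piece_act T \<tau> w y' = piece_act T \<tau> u y'"
      unfolding q(2) by (rule piece_act_shift[OF T _ q(1)])
    then show ?thesis
      using equiv_class_eq[OF equiv_glue_rel glue_rel_act[OF P', of u]] by simp
  qed
  have self: "(\<sigma>, \<delta>, y) \<in> glue_rel T `` {(\<sigma>, \<delta>, y)}"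
    by (rule equiv_class_self[OF equiv_glue_rel P])
  show ?thesis
  proof (intro subset_antisym subsetI)
    fix p assume "p \<in> quasitorus_act T (torus_rel T `` {u}) (glue_rel T `` {(\<sigma>, \<delta>, y)})"
    then obtain w \<tau> \<gamma> y' where "w \<in> torus_rel T `` {u}" "((\<sigma>, \<delta>, y), (\<tau>, \<gamma>, y')) \<in> glue_rel T"
      "p \<in> glue_rel T `` {(\<tau>, \<gamma>, piece_act T \<tau> w y')}"
      unfolding quasitorus_act_def by auto
    then show "p \<in> glue_rel T `` {(\<sigma>, \<delta>, piece_act T \<sigma> u y)}" using cls by metis
  next
    fix p assume "p \<in> glue_rel T `` {(\<sigma>, \<delta>, piece_act T \<sigma> u y)}"
    then show "p \<in> quasitorus_act T (torus_rel T `` {u}) (glue_rel T `` {(\<sigma>, \<delta>, y)})"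
      unfolding quasitorus_act_def by (intro UN_I[OF torus_rel_self] UN_I[OF self]) simp
  qed
qed

end

lemma (in quasilattice_map) quasitorus_hom_class:
  "quasitorus_hom T\<^sub>2 f (torus_rel T\<^sub>1 `` {u}) = torus_rel T\<^sub>2 `` {clinear_map f u}"
proof -
  have "torus_rel T\<^sub>2 `` {clinear_map f w} = torus_rel T\<^sub>2 `` {clinear_map f u}"
    if w: "w \<in> torus_rel T\<^sub>1 `` {u}" for w
  proof -
    obtain q where q: "q \<in> qlat T\<^sub>1" "w = u + (\<chi> k. of_real (q $ k))"
      using w unfolding torus_rel_iff by (rule bexE)
    have "f q \<in> qlat T\<^sub>2" using qlat q(1) by blast
    then show ?thesis unfolding q(2) clinear_map_add by (rule torus_rel_shift[OF T\<^sub>2])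
  qed
  then show ?thesis unfolding quasitorus_hom_def using torus_rel_self[OF T\<^sub>1, of u] by blast
qed

section \<open>The induced map\<close>

text \<open>No target chart is canonical, so all of them are kept and no choice is made. That they
  lead to the same class is a case of \<open>affine_toric_map_glue\<close>.\<close>

definition toric_targets ::
  "'m::finite fan_triple \<Rightarrow> (real^'n::finite \<Rightarrow> real^'m) \<Rightarrow> (real^'n) set \<Rightarrow>
     ((real^'m) set \<times> (real^'m) set) set" where
  "toric_targets T\<^sub>2 f \<delta>\<^sub>1 =
     {(\<sigma>\<^sub>2, \<delta>\<^sub>2). \<sigma>\<^sub>2 \<in> max_cones T\<^sub>2 \<and> cone_face \<delta>\<^sub>2 \<sigma>\<^sub>2 \<and> f ` \<delta>\<^sub>1 \<subseteq> \<delta>\<^sub>2}"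

text \<open>The union over all representatives and all admissible target pieces is a single class.\<close>
definition toric_map ::
  "'n::finite fan_triple \<Rightarrow> 'm::finite fan_triple \<Rightarrow> (real^'n \<Rightarrow> real^'m) \<Rightarrow>
     'n piece_point set \<Rightarrow> 'm piece_point set" where
  "toric_map T\<^sub>1 T\<^sub>2 f p =
     (\<Union>(\<sigma>\<^sub>1, \<delta>\<^sub>1, y)\<in>p. \<Union>(\<sigma>\<^sub>2, \<delta>\<^sub>2)\<in>toric_targets T\<^sub>2 f \<delta>\<^sub>1.
        glue_rel T\<^sub>2 `` {(\<sigma>\<^sub>2, \<delta>\<^sub>2, affine_toric_map T\<^sub>1 T\<^sub>2 f \<sigma>\<^sub>1 \<sigma>\<^sub>2 y)})"

context quasilattice_map
begin

lemma toric_targetsD: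
  assumes "(\<sigma>\<^sub>2, \<delta>\<^sub>2) \<in> toric_targets T\<^sub>2 f \<delta>\<^sub>1"
  shows "\<sigma>\<^sub>2 \<in> max_cones T\<^sub>2" "cone_face \<delta>\<^sub>2 \<sigma>\<^sub>2" "f ` \<delta>\<^sub>1 \<subseteq> \<delta>\<^sub>2" "\<delta>\<^sub>2 \<in> fan T\<^sub>2" "\<delta>\<^sub>2 \<subseteq> \<sigma>\<^sub>2"
proof -
  show *: "\<sigma>\<^sub>2 \<in> max_cones T\<^sub>2" "cone_face \<delta>\<^sub>2 \<sigma>\<^sub>2" "f ` \<delta>\<^sub>1 \<subseteq> \<delta>\<^sub>2"
    using assms unfolding toric_targets_def by blast+
  show "\<delta>\<^sub>2 \<in> fan T\<^sub>2" "\<delta>\<^sub>2 \<subseteq> \<sigma>\<^sub>2" using max_cone_face[OF T\<^sub>2 *(1,2)] .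
qed

lemma affine_toric_map_piece_points:
  assumes P: "(\<sigma>\<^sub>1, \<delta>\<^sub>1, y) \<in> piece_points T\<^sub>1" and t: "(\<sigma>\<^sub>2, \<delta>\<^sub>2) \<in> toric_targets T\<^sub>2 f \<delta>\<^sub>1"
  shows "(\<sigma>\<^sub>2, \<delta>\<^sub>2, affine_toric_map T\<^sub>1 T\<^sub>2 f \<sigma>\<^sub>1 \<sigma>\<^sub>2 y) \<in> piece_points T\<^sub>2"
proof -
  note t = toric_targetsD[OF t]
  have *: "\<sigma>\<^sub>1 \<in> max_cones T\<^sub>1" "cone_face \<delta>\<^sub>1 \<sigma>\<^sub>1" "y \<in> affine_piece T\<^sub>1 \<sigma>\<^sub>1 \<delta>\<^sub>1"
    using P unfolding piece_points_iff by blast+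
  show ?thesis
    unfolding piece_points_iff
    by (intro conjI t(1,2) affine_toric_map_piece[OF *(1) t(1) max_cone_face(1)[OF T\<^sub>1 *(1,2)] t(4,5,3) *(3)])
qed

text \<open>A commuting square: over the overlap
  \<open>\<delta>\<^sub>1 \<inter> \<gamma>\<^sub>1\<close>, source gluing followed by
  \<open>f\<close> and \<open>f\<close> followed by target gluing are both the affine morphism of
  \<open>f\<close>. The cone \<open>\<delta>\<^sub>2 \<inter> \<gamma>\<^sub>2\<close> contains the
  image of the overlap and mediates. For two equal source points this is independence of the target
  chart.\<close>

lemma affine_toric_map_glue:
  assumes P: "((\<sigma>\<^sub>1, \<delta>\<^sub>1, y), (\<tau>\<^sub>1, \<gamma>\<^sub>1, y')) \<in> glue_rel T\<^sub>1"
    and t: "(\<sigma>\<^sub>2, \<delta>\<^sub>2) \<in> toric_targets T\<^sub>2 f \<delta>\<^sub>1" and t': "(\<tau>\<^sub>2, \<gamma>\<^sub>2) \<in> toric_targets T\<^sub>2 f \<gamma>\<^sub>1"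
  shows "((\<sigma>\<^sub>2, \<delta>\<^sub>2, affine_toric_map T\<^sub>1 T\<^sub>2 f \<sigma>\<^sub>1 \<sigma>\<^sub>2 y),
    (\<tau>\<^sub>2, \<gamma>\<^sub>2, affine_toric_map T\<^sub>1 T\<^sub>2 f \<tau>\<^sub>1 \<tau>\<^sub>2 y')) \<in> glue_rel T\<^sub>2"
proof (rule glue_relE[OF T\<^sub>1 P])
  note D = toric_targetsD[OF t] and D' = toric_targetsD[OF t']
  assume \<sigma>: "\<sigma>\<^sub>1 \<in> max_cones T\<^sub>1" "\<tau>\<^sub>1 \<in> max_cones T\<^sub>1"
    and pp: "(\<sigma>\<^sub>1, \<delta>\<^sub>1, y) \<in> piece_points T\<^sub>1" "(\<tau>\<^sub>1, \<gamma>\<^sub>1, y') \<in> piece_points T\<^sub>1"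
    and \<gamma>\<^sub>1: "\<gamma>\<^sub>1 \<subseteq> \<tau>\<^sub>1" and \<kappa>\<^sub>1: "\<delta>\<^sub>1 \<inter> \<gamma>\<^sub>1 \<in> fan T\<^sub>1" and y: "y \<in> affine_piece T\<^sub>1 \<sigma>\<^sub>1 (\<delta>\<^sub>1 \<inter> \<gamma>\<^sub>1)"
    and y': "y' = affine_toric_map T\<^sub>1 T\<^sub>1 id \<sigma>\<^sub>1 \<tau>\<^sub>1 y"
  have sub: "\<delta>\<^sub>1 \<inter> \<gamma>\<^sub>1 \<subseteq> \<tau>\<^sub>1" "\<delta>\<^sub>2 \<inter> \<gamma>\<^sub>2 \<subseteq> \<sigma>\<^sub>2" "\<delta>\<^sub>2 \<inter> \<gamma>\<^sub>2 \<subseteq> \<tau>\<^sub>2" "f ` (\<delta>\<^sub>1 \<inter> \<gamma>\<^sub>1) \<subseteq> \<delta>\<^sub>2 \<inter> \<gamma>\<^sub>2"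
    using \<gamma>\<^sub>1 D(5) D'(5) D(3) D'(3) by auto
  have \<kappa>\<^sub>2: "\<delta>\<^sub>2 \<inter> \<gamma>\<^sub>2 \<in> fan T\<^sub>2" by (rule fan_Int(3)[OF T\<^sub>2 D(4) D'(4)])
  have qm: "quasilattice_map T\<^sub>1 T\<^sub>2 f" by unfold_locales
  have "affine_toric_map T\<^sub>1 T\<^sub>2 f \<tau>\<^sub>1 \<tau>\<^sub>2 y' = affine_toric_map T\<^sub>1 T\<^sub>2 (f \<circ> id) \<sigma>\<^sub>1 \<tau>\<^sub>2 y"
    unfolding y'
    by (rule affine_toric_map_comp[OF quasilattice_map_id[OF T\<^sub>1] qm \<sigma> D'(1) \<kappa>\<^sub>1 \<kappa>\<^sub>1 sub(1) \<kappa>\<^sub>2 sub(3) _ sub(4) y]) simp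
  also have "\<dots> = affine_toric_map T\<^sub>1 T\<^sub>2 (id \<circ> f) \<sigma>\<^sub>1 \<tau>\<^sub>2 y" by simp
  also have "\<dots> = affine_toric_map T\<^sub>2 T\<^sub>2 id \<sigma>\<^sub>2 \<tau>\<^sub>2 (affine_toric_map T\<^sub>1 T\<^sub>2 f \<sigma>\<^sub>1 \<sigma>\<^sub>2 y)"
    by (rule affine_toric_map_comp[OF qm quasilattice_map_id[OF T\<^sub>2] \<sigma>(1) D(1) D'(1) \<kappa>\<^sub>1 \<kappa>\<^sub>2 sub(2) \<kappa>\<^sub>2 sub(3,4) _ y, symmetric]) simp
  finally show ?thesis
    by (intro glue_relI[OF T\<^sub>2 affine_toric_map_piece_points[OF pp(1) t]
      affine_toric_map_piece_points[OF pp(2) t'] \<kappa>\<^sub>2 order_refl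
      affine_toric_map_piece[OF \<sigma>(1) D(1) \<kappa>\<^sub>1 \<kappa>\<^sub>2 sub(2,4) y]])
qed

lemma toric_map_class:
  assumes P: "(\<sigma>\<^sub>1, \<delta>\<^sub>1, y) \<in> piece_points T\<^sub>1" and t: "(\<sigma>\<^sub>2, \<delta>\<^sub>2) \<in> toric_targets T\<^sub>2 f \<delta>\<^sub>1"
  shows "toric_map T\<^sub>1 T\<^sub>2 f (glue_rel T\<^sub>1 `` {(\<sigma>\<^sub>1, \<delta>\<^sub>1, y)}) =
    glue_rel T\<^sub>2 `` {(\<sigma>\<^sub>2, \<delta>\<^sub>2, affine_toric_map T\<^sub>1 T\<^sub>2 f \<sigma>\<^sub>1 \<sigma>\<^sub>2 y)}" (is "_ = ?C")
proof (intro subset_antisym subsetI)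
  fix p assume "p \<in> toric_map T\<^sub>1 T\<^sub>2 f (glue_rel T\<^sub>1 `` {(\<sigma>\<^sub>1, \<delta>\<^sub>1, y)})"
  then obtain \<tau>\<^sub>1 \<gamma>\<^sub>1 y' \<tau>\<^sub>2 \<gamma>\<^sub>2 where "((\<sigma>\<^sub>1, \<delta>\<^sub>1, y), (\<tau>\<^sub>1, \<gamma>\<^sub>1, y')) \<in> glue_rel T\<^sub>1"
    "(\<tau>\<^sub>2, \<gamma>\<^sub>2) \<in> toric_targets T\<^sub>2 f \<gamma>\<^sub>1"
    "p \<in> glue_rel T\<^sub>2 `` {(\<tau>\<^sub>2, \<gamma>\<^sub>2, affine_toric_map T\<^sub>1 T\<^sub>2 f \<tau>\<^sub>1 \<tau>\<^sub>2 y')}"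
    unfolding toric_map_def by auto
  then show "p \<in> ?C"
    using equiv_class_eq[OF equiv_glue_rel[OF T\<^sub>2] affine_toric_map_glue[OF _ t]] by metis
next
  fix p assume "p \<in> ?C"
  then show "p \<in> toric_map T\<^sub>1 T\<^sub>2 f (glue_rel T\<^sub>1 `` {(\<sigma>\<^sub>1, \<delta>\<^sub>1, y)})"
    unfolding toric_map_def
    by (intro UN_I[OF equiv_class_self[OF equiv_glue_rel[OF T\<^sub>1] P]]) (use t in \<open>auto intro!: bexI\<close>)
qed

lemma toric_map_equivariant:
  assumes P: "(\<sigma>\<^sub>1, \<delta>\<^sub>1, y) \<in> piece_points T\<^sub>1" and t: "(\<sigma>\<^sub>2, \<delta>\<^sub>2) \<in> toric_targets T\<^sub>2 f \<delta>\<^sub>1"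
  shows "toric_map T\<^sub>1 T\<^sub>2 f (quasitorus_act T\<^sub>1 (torus_rel T\<^sub>1 `` {u}) (glue_rel T\<^sub>1 `` {(\<sigma>\<^sub>1, \<delta>\<^sub>1, y)})) =
    quasitorus_act T\<^sub>2 (quasitorus_hom T\<^sub>2 f (torus_rel T\<^sub>1 `` {u}))
      (toric_map T\<^sub>1 T\<^sub>2 f (glue_rel T\<^sub>1 `` {(\<sigma>\<^sub>1, \<delta>\<^sub>1, y)}))"
proof -
  have *: "\<sigma>\<^sub>1 \<in> max_cones T\<^sub>1" "y \<in> affine_piece T\<^sub>1 \<sigma>\<^sub>1 \<delta>\<^sub>1"
    using P unfolding piece_points_iff by blast+
  show ?thesis
    unfolding quasitorus_act_class[OF T\<^sub>1 P] quasitorus_hom_class toric_map_class[OF P t]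
      toric_map_class[OF piece_points_act[OF T\<^sub>1 P] t]
      quasitorus_act_class[OF T\<^sub>2 affine_toric_map_piece_points[OF P t]]
      affine_toric_map_piece_act[OF *(1) toric_targetsD(1)[OF t] *(2)] ..
qed

end

theorem theorem5p1:
  fixes T\<^sub>1 :: "'n::finite fan_triple" and T\<^sub>2 :: "'m::finite fan_triple"
    and f :: "real^'n \<Rightarrow> real^'m"
  assumes "fan_fundamental_triple T\<^sub>1" and "fan_fundamental_triple T\<^sub>2"
    and "convex (fan_support T\<^sub>1)" and "aff_dim (fan_support T\<^sub>1) = int CARD('n)"
    and "convex (fan_support T\<^sub>2)" and "aff_dim (fan_support T\<^sub>2) = int CARD('m)"
    and "fan_morphism T\<^sub>1 T\<^sub>2 f"
  shows "\<exists>\<Phi>. \<Phi> \<in> toric_quasifold T\<^sub>1 \<rightarrow> toric_quasifold T\<^sub>2 \<and>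
    induced_by T\<^sub>1 T\<^sub>2 f \<Phi> \<and> quasitorus_equivariant T\<^sub>1 T\<^sub>2 f \<Phi>"
proof -
  have f: "linear f" "f ` qlat T\<^sub>1 \<subseteq> qlat T\<^sub>2" "\<And>\<delta>\<^sub>1. \<delta>\<^sub>1 \<in> fan T\<^sub>1 \<Longrightarrow> \<exists>\<delta>\<^sub>2\<in>fan T\<^sub>2. f ` \<delta>\<^sub>1 \<subseteq> \<delta>\<^sub>2"
    using assms(7) unfolding fan_morphism_def by blast+
  interpret quasilattice_map T\<^sub>1 T\<^sub>2 f by (rule quasilattice_map.intro[OF assms(1,2) f(1,2)])
  have target: "\<exists>\<sigma>\<^sub>2 \<delta>\<^sub>2. (\<sigma>\<^sub>2, \<delta>\<^sub>2) \<in> toric_targets T\<^sub>2 f \<delta>\<^sub>1"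
    if \<delta>\<^sub>1: "\<sigma>\<^sub>1 \<in> max_cones T\<^sub>1" "cone_face \<delta>\<^sub>1 \<sigma>\<^sub>1" for \<sigma>\<^sub>1 \<delta>\<^sub>1
  proof -
    obtain \<delta>\<^sub>2 where "\<delta>\<^sub>2 \<in> fan T\<^sub>2" "f ` \<delta>\<^sub>1 \<subseteq> \<delta>\<^sub>2"
      using f(3)[OF max_cone_face(1)[OF assms(1) \<delta>\<^sub>1]] by blast
    moreover obtain \<sigma>\<^sub>2 where "\<sigma>\<^sub>2 \<in> max_cones T\<^sub>2" "cone_face \<delta>\<^sub>2 \<sigma>\<^sub>2"
      using fan_cone_in_max_cone[OF assms(2,5,6) \<open>\<delta>\<^sub>2 \<in> fan T\<^sub>2\<close>] .
    ultimately show ?thesis unfolding toric_targets_def by blast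
  qed
  have point: "\<exists>\<sigma>\<^sub>1 \<delta>\<^sub>1 y \<sigma>\<^sub>2 \<delta>\<^sub>2. p = glue_rel T\<^sub>1 `` {(\<sigma>\<^sub>1, \<delta>\<^sub>1, y)} \<and>
      (\<sigma>\<^sub>1, \<delta>\<^sub>1, y) \<in> piece_points T\<^sub>1 \<and> (\<sigma>\<^sub>2, \<delta>\<^sub>2) \<in> toric_targets T\<^sub>2 f \<delta>\<^sub>1"
    if p: "p \<in> toric_quasifold T\<^sub>1" for p
  proof -
    obtain \<sigma>\<^sub>1 \<delta>\<^sub>1 y where P: "(\<sigma>\<^sub>1, \<delta>\<^sub>1, y) \<in> piece_points T\<^sub>1" "p = glue_rel T\<^sub>1 `` {(\<sigma>\<^sub>1, \<delta>\<^sub>1, y)}"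
      using p unfolding toric_quasifold_def by (auto elim!: quotientE)
    have "\<sigma>\<^sub>1 \<in> max_cones T\<^sub>1" "cone_face \<delta>\<^sub>1 \<sigma>\<^sub>1" using P(1) unfolding piece_points_iff by blast+
    from target[OF this] P show ?thesis by blast
  qed
  let ?\<Phi> = "toric_map T\<^sub>1 T\<^sub>2 f"
  have "?\<Phi> \<in> toric_quasifold T\<^sub>1 \<rightarrow> toric_quasifold T\<^sub>2"
  proof
    fix p assume "p \<in> toric_quasifold T\<^sub>1"
    from point[OF this] obtain \<sigma>\<^sub>1 \<delta>\<^sub>1 y \<sigma>\<^sub>2 \<delta>\<^sub>2 where p: "p = glue_rel T\<^sub>1 `` {(\<sigma>\<^sub>1, \<delta>\<^sub>1, y)}"
      and P: "(\<sigma>\<^sub>1, \<delta>\<^sub>1, y) \<in> piece_points T\<^sub>1" and t: "(\<sigma>\<^sub>2, \<delta>\<^sub>2) \<in> toric_targets T\<^sub>2 f \<delta>\<^sub>1" by blast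
    show "?\<Phi> p \<in> toric_quasifold T\<^sub>2"
      unfolding p toric_map_class[OF P t] toric_quasifold_def
      by (rule quotientI[OF affine_toric_map_piece_points[OF P t]])
  qed
  moreover have "induced_by T\<^sub>1 T\<^sub>2 f ?\<Phi>"
    unfolding induced_by_def
  proof (intro ballI allI impI conjI)
    fix \<sigma>\<^sub>1 \<delta>\<^sub>1 assume \<sigma>\<^sub>1: "\<sigma>\<^sub>1 \<in> max_cones T\<^sub>1" "cone_face \<delta>\<^sub>1 \<sigma>\<^sub>1"
    show "\<exists>\<sigma>\<^sub>2\<in>max_cones T\<^sub>2. \<exists>\<delta>\<^sub>2. cone_face \<delta>\<^sub>2 \<sigma>\<^sub>2 \<and> f ` \<delta>\<^sub>1 \<subseteq> \<delta>\<^sub>2"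
      using target[OF \<sigma>\<^sub>1] unfolding toric_targets_def by blast
    fix \<sigma>\<^sub>2 \<delta>\<^sub>2 y assume "\<sigma>\<^sub>2 \<in> max_cones T\<^sub>2" "cone_face \<delta>\<^sub>2 \<sigma>\<^sub>2 \<and> f ` \<delta>\<^sub>1 \<subseteq> \<delta>\<^sub>2"
    then have t: "(\<sigma>\<^sub>2, \<delta>\<^sub>2) \<in> toric_targets T\<^sub>2 f \<delta>\<^sub>1" unfolding toric_targets_def by blast
    assume "y \<in> affine_piece T\<^sub>1 \<sigma>\<^sub>1 \<delta>\<^sub>1"
    then have P: "(\<sigma>\<^sub>1, \<delta>\<^sub>1, y) \<in> piece_points T\<^sub>1" using \<sigma>\<^sub>1 unfolding piece_points_iff by blast
    show "affine_toric_map T\<^sub>1 T\<^sub>2 f \<sigma>\<^sub>1 \<sigma>\<^sub>2 y \<in> affine_piece T\<^sub>2 \<sigma>\<^sub>2 \<delta>\<^sub>2"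
      using affine_toric_map_piece_points[OF P t] unfolding piece_points_iff by blast
    show "?\<Phi> (glue_rel T\<^sub>1 `` {(\<sigma>\<^sub>1, \<delta>\<^sub>1, y)}) =
        glue_rel T\<^sub>2 `` {(\<sigma>\<^sub>2, \<delta>\<^sub>2, affine_toric_map T\<^sub>1 T\<^sub>2 f \<sigma>\<^sub>1 \<sigma>\<^sub>2 y)}"
      by (rule toric_map_class[OF P t])
  qed
  moreover have "quasitorus_equivariant T\<^sub>1 T\<^sub>2 f ?\<Phi>"
    unfolding quasitorus_equivariant_def
  proof (intro ballI)
    fix t p assume "t \<in> quasitorus T\<^sub>1" "p \<in> toric_quasifold T\<^sub>1"
    obtain u where u: "t = torus_rel T\<^sub>1 `` {u}"
      using \<open>t \<in> quasitorus T\<^sub>1\<close> unfolding quasitorus_def by (rule quotientE)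
    from point[OF \<open>p \<in> toric_quasifold T\<^sub>1\<close>] obtain \<sigma>\<^sub>1 \<delta>\<^sub>1 y \<sigma>\<^sub>2 \<delta>\<^sub>2
      where p: "p = glue_rel T\<^sub>1 `` {(\<sigma>\<^sub>1, \<delta>\<^sub>1, y)}"
      and P: "(\<sigma>\<^sub>1, \<delta>\<^sub>1, y) \<in> piece_points T\<^sub>1" and t: "(\<sigma>\<^sub>2, \<delta>\<^sub>2) \<in> toric_targets T\<^sub>2 f \<delta>\<^sub>1" by blast
    show "?\<Phi> (quasitorus_act T\<^sub>1 t p) = quasitorus_act T\<^sub>2 (quasitorus_hom T\<^sub>2 f t) (?\<Phi> p)"
      unfolding u p by (rule toric_map_equivariant[OF P t])
  qed
  ultimately show ?thesis by blast
qed

end
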